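(* Let $\mathscr{M}=L^2(\Omega)$, let $\mathcal{F}:\mathscr{M}\to\mathbb{R}^d$ be a bounded linear operator, let $\sigma>0$, let $\mu_{\mathrm{pr}}=\mathsf{N}(m_{\mathrm{pr}},\mathcal{C}_{\mathrm{pr}})$ be the Gaussian prior measure on $\mathscr{M}$, and for $\boldsymbol{y}\in\mathbb{R}^d$ let $\mu_{\mathrm{post}}^{\boldsymbol{y}}$ be the posterior measure of the Bayesian linear inverse problem with data model $\boldsymbol{y}\,|\,m\sim\mathsf{N}(\mathcal{F}m,\sigma^2\mathbf{I})$, whose covariance operator is $\mathcal{C}_{\mathrm{post}}$. Let $\mathcal{Z}:\mathscr{M}\to\mathbb{R}$ be twice differentiable, let $\bar m\in\mathscr{M}$ be fixed, put $\bar g:=\nabla\mathcal{Z}(\bar m)$ and $\bar{\mathcal{H}}:=\nabla^2\mathcal{Z}(\bar m)$, and let $$\mathcal{Z}_{\mathrm{quad}}(m):=\mathcal{Z}(\bar m)+\langle\bar g,m-\bar m\rangle+\frac12\langle\bar{\mathcal{H}}(m-\bar m),m-\bar m\rangle .$$ Define $$\Psi:=\mathbb{E}_{\mu_{\mathrm{pr}}}\Big\{\mathbb{E}_{\boldsymbol{y}|m}\big\{\mathbb{V}_{\mu_{\mathrm{post}}^{\boldsymbol{y}}}\{\mathcal{Z}_{\mathrm{quad}}\}\big\}\Big\}.$$ Then $$\Psi=\|\bar{\mathcal{H}}(m_{\mathrm{pr}}-\bar m)+\bar g\|_{\mathcal{C}_{\mathrm{post}}}^2+\mathrm{tr}\b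ig(\mathcal{C}_{\mathrm{pr}}\bar{\mathcal{H}}\,\mathcal{C}_{\mathrm{post}}\bar{\mathcal{H}}\big)-\frac12\,\mathrm{tr}\big((\mathcal{C}_{\mathrm{post}}\bar{\mathcal{H}})^2\big).$$
   Context: $\Omega$ is a bounded domain in two or three space dimensions and $\mathscr{M}=L^2(\Omega)$ carries the usual real inner product $\langle\cdot,\cdot\rangle$. Prior: $\mu_{\mathrm{pr}}=\mathsf{N}(m_{\mathrm{pr}},\mathcal{C}_{\mathrm{pr}})$ is Gaussian with $\mathcal{C}_{\mathrm{pr}}:=\mathcal{E}^2$, where $\mathcal{E}:s\mapsto m$ is the solution operator of $a_1(-a_2\Delta m+m)=s$ in $\Omega$ with $\nabla m\cdot\boldsymbol{n}=0$ on $\partial\Omega$, for positive constants $a_1,a_2$. It is understood that $\Omega$ is such that $\mathcal{C}_{\mathrm{pr}}$ is a strictly positive selfadjoint trace-class operator on $\mathscr{M}$ (so that $\mu_{\mathrm{pr}}$ is a well-defined Gaussian measure). The prior mean $m_{\mathrm{pr}}\in\mathscr{M}$ is sufficiently regular, meaning that $m_{\mathrm{pr}}\in\mathrm{range}(\mathcal{C}_{\mathrm{pr}})$ so that $\mathcal{C}_{\mathrm{pr}}^{-1}m_{\mathrm{pr}}$ makes sense. Likelihood: $\boldsymbol{y}=\mathcal{F}m+\boldsymbol{\eta}$ with $\boldsymbol{\eta}\sim\mathsf{N}(0,\sigma^2\mathbf{I})$ independent of $m$, so $\boldsymbol{y}|m\sim\mathsf{N}(\mathcal{F}m,\sigma^2\mathbf{I})$.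 Posterior: $\mu_{\mathrm{post}}^{\boldsymbol{y}}=\mathsf{N}(m_{\mathrm{MAP}}^{\boldsymbol{y}},\mathcal{C}_{\mathrm{post}})$ with $\mathcal{C}_{\mathrm{post}}=(\sigma^{-2}\mathcal{F}^*\mathcal{F}+\mathcal{C}_{\mathrm{pr}}^{-1})^{-1}$ and $m_{\mathrm{MAP}}^{\boldsymbol{y}}=\mathcal{C}_{\mathrm{post}}(\sigma^{-2}\mathcal{F}^*\boldsymbol{y}+\mathcal{C}_{\mathrm{pr}}^{-1}m_{\mathrm{pr}})$, where $\mathcal{F}^*$ is the adjoint of $\mathcal{F}$. The gradient $\nabla\mathcal{Z}(\bar m)\in\mathscr{M}$ and Hessian $\nabla^2\mathcal{Z}(\bar m)$ (a bounded selfadjoint operator on $\mathscr{M}$) are those with respect to $\langle\cdot,\cdot\rangle$. $\mathbb{V}_\mu\{\cdot\}$ is the variance with respect to $\mu$; $\mathbb{E}_{\mu_{\mathrm{pr}}}$ is expectation over $m\sim\mu_{\mathrm{pr}}$ and $\mathbb{E}_{\boldsymbol{y}|m}$ is expectation over $\boldsymbol{y}\sim\mathsf{N}(\mathcal{F}m,\sigma^2\mathbf{I})$. The weighted norm is $\|x\|_{\mathcal{C}}^2:=\langle\mathcal{C}x,x\rangle$. *)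

theory Defs
  imports "HOL-Probability.Probability"
begin

definition bounded_domain :: "(real ^ 'n) set \<Rightarrow> bool" where
  "bounded_domain \<Omega> \<longleftrightarrow> open \<Omega> \<and> connected \<Omega> \<and> bounded \<Omega> \<and> \<Omega> \<noteq> {}"

definition square_integrable_on :: "(real ^ 'n \<Rightarrow> real) \<Rightarrow> (real ^ 'n) set \<Rightarrow> bool" where
  "square_integrable_on f \<Omega> \<longleftrightarrow>
     f \<in> borel_measurable (lebesgue_on \<Omega>) \<and> integrable (lebesgue_on \<Omega>) (\<lambda>x. (f x)\<^sup>2)"

text \<open>
  A type cannot depend on the set \<open>\<Omega>\<close>, so the Hilbert space \<open>L\<^sup>2(\<Omega>)\<close> is given as a type \<open>'h\<close>
  together with the map \<open>cls\<close> that sends a square-integrable function to its class. Preservation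
  of inner products gives linearity of \<open>cls\<close> on square-integrable functions, and
  \<open>cls f = cls g\<close> holds iff \<open>f = g\<close> almost everywhere on \<open>\<Omega>\<close>. With surjectivity, \<open>'h\<close> is
  therefore exactly the quotient of the square-integrable functions by almost-everywhere equality,
  and it is complete and separable because \<open>L\<^sup>2(\<Omega>)\<close> is.
\<close>

definition L2_space :: "(real ^ 'n) set \<Rightarrow> ((real ^ 'n \<Rightarrow> real) \<Rightarrow> 'h::real_inner) \<Rightarrow> bool" where
  "L2_space \<Omega> cls \<longleftrightarrow>
     (\<forall>f g. square_integrable_on f \<Omega> \<longrightarrow> square_integrable_on g \<Omega> \<longrightarrow>
        cls f \<bullet> cls g = (\<integral>x. f x * g x \<partial>lebesgue_on \<Omega>)) \<and>
     cls ` {f. square_integrable_on f \<Omega>} = UNIV"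

definition partial_deriv :: "'n \<Rightarrow> (real ^ 'n \<Rightarrow> real) \<Rightarrow> real ^ 'n \<Rightarrow> real" where
  "partial_deriv i f = (\<lambda>x. frechet_derivative f (at x) (axis i 1))"

text \<open>Smooth: all iterated partial derivatives exist and are differentiable everywhere.\<close>

definition smooth_fun :: "(real ^ 'n \<Rightarrow> real) \<Rightarrow> bool" where
  "smooth_fun f \<longleftrightarrow> (\<forall>is x. foldr partial_deriv is f differentiable (at x))"

definition test_fun :: "(real ^ 'n) set \<Rightarrow> (real ^ 'n \<Rightarrow> real) \<Rightarrow> bool" where
  "test_fun \<Omega> \<phi> \<longleftrightarrow> smooth_fun \<phi> \<and> compact (closure {x. \<phi> x \<noteq> 0}) \<and> closure {x. \<phi> x \<noteq> 0} \<subseteq> \<Omega>"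

definition weak_partial ::
  "(real ^ 'n) set \<Rightarrow> ((real ^ 'n \<Rightarrow> real) \<Rightarrow> 'h::real_inner) \<Rightarrow> 'n \<Rightarrow> 'h \<Rightarrow> 'h \<Rightarrow> bool" where
  "weak_partial \<Omega> cls i u g \<longleftrightarrow>
     (\<forall>\<phi>. test_fun \<Omega> \<phi> \<longrightarrow> u \<bullet> cls (partial_deriv i \<phi>) = - (g \<bullet> cls \<phi>))"

text \<open>
  An element \<open>u\<close> lies in \<open>H\<^sup>1(\<Omega>)\<close> with gradient \<open>G\<close> iff \<open>weak_grad \<Omega> cls u G\<close>.
\<close>

definition weak_grad ::
  "(real ^ 'n) set \<Rightarrow> ((real ^ 'n \<Rightarrow> real) \<Rightarrow> 'h::real_inner) \<Rightarrow> 'h \<Rightarrow> ('n \<Rightarrow> 'h) \<Rightarrow> bool" where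
  "weak_grad \<Omega> cls u G \<longleftrightarrow> (\<forall>i. weak_partial \<Omega> cls i u (G i))"

text \<open>
  Variational form of \<open>a1 (- a2 \<Delta>m + m) = s\<close> in \<open>\<Omega>\<close> with \<open>\<nabla>m \<cdot> n = 0\<close> on the boundary. The
  Neumann condition is the natural boundary condition: it is encoded by letting the test element
  \<open>v\<close> range over all of \<open>H\<^sup>1(\<Omega>)\<close>.
\<close>

definition neumann_solution ::
  "(real ^ 'n) set \<Rightarrow> ((real ^ 'n \<Rightarrow> real) \<Rightarrow> 'h::real_inner) \<Rightarrow> real \<Rightarrow> real \<Rightarrow> 'h \<Rightarrow> 'h \<Rightarrow> bool" where
  "neumann_solution \<Omega> cls a1 a2 s m \<longleftrightarrow>
     (\<exists>G. weak_grad \<Omega> cls m G \<and>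
        (\<forall>v D. weak_grad \<Omega> cls v D \<longrightarrow>
           a1 * (a2 * (\<Sum>i\<in>UNIV. G i \<bullet> D i) + m \<bullet> v) = s \<bullet> v))"

definition solution_op ::
  "(real ^ 'n) set \<Rightarrow> ((real ^ 'n \<Rightarrow> real) \<Rightarrow> 'h::real_inner) \<Rightarrow> real \<Rightarrow> real \<Rightarrow> 'h \<Rightarrow> 'h" where
  "solution_op \<Omega> cls a1 a2 s = (THE m. neumann_solution \<Omega> cls a1 a2 s m)"

definition prior_cov ::
  "(real ^ 'n) set \<Rightarrow> ((real ^ 'n \<Rightarrow> real) \<Rightarrow> 'h::real_inner) \<Rightarrow> real \<Rightarrow> real \<Rightarrow> 'h \<Rightarrow> 'h" where
  "prior_cov \<Omega> cls a1 a2 = solution_op \<Omega> cls a1 a2 \<circ> solution_op \<Omega> cls a1 a2"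

definition selfadjoint_op :: "('h::real_inner \<Rightarrow> 'h) \<Rightarrow> bool" where
  "selfadjoint_op T \<longleftrightarrow> bounded_linear T \<and> (\<forall>x y. T x \<bullet> y = x \<bullet> T y)"

definition strictly_positive_op :: "('h::real_inner \<Rightarrow> 'h) \<Rightarrow> bool" where
  "strictly_positive_op T \<longleftrightarrow> (\<forall>x. x \<noteq> 0 \<longrightarrow> T x \<bullet> x > 0)"

text \<open>On a Hilbert space the trace-class operators are the nuclear ones.\<close>

definition trace_class_op :: "('h::real_inner \<Rightarrow> 'h) \<Rightarrow> bool" where
  "trace_class_op T \<longleftrightarrow> bounded_linear T \<and>
     (\<exists>a b :: nat \<Rightarrow> 'h. summable (\<lambda>n. norm (a n) * norm (b n)) \<and>
        (\<forall>x. (\<lambda>n. (a n \<bullet> x) *\<^sub>R b n) sums T x))"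

definition orthonormal_basis :: "'h::real_inner set \<Rightarrow> bool" where
  "orthonormal_basis B \<longleftrightarrow>
     (\<forall>e\<in>B. norm e = 1) \<and> (\<forall>e\<in>B. \<forall>f\<in>B. e \<noteq> f \<longrightarrow> e \<bullet> f = 0) \<and> closure (span B) = UNIV"

text \<open>For a trace-class operator the sum is the same in every orthonormal basis.\<close>

definition op_trace :: "('h::real_inner \<Rightarrow> 'h) \<Rightarrow> real" where
  "op_trace T = (THE t. \<forall>B. orthonormal_basis B \<longrightarrow> ((\<lambda>e. T e \<bullet> e) has_sum t) B)"

definition weighted_norm_sq :: "('h::real_inner \<Rightarrow> 'h) \<Rightarrow> 'h \<Rightarrow> real" where
  "weighted_norm_sq C x = C x \<bullet> x"

text \<open>Normal law with mean \<open>a\<close> and standard deviation \<open>s\<close>; a point mass if \<open>s = 0\<close>.\<close>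

definition normal_law :: "real \<Rightarrow> real \<Rightarrow> real measure" where
  "normal_law a s =
     (if s = 0 then return borel a else density lborel (\<lambda>x. ennreal (normal_density a s x)))"

definition gaussian_measure :: "'h::real_inner measure \<Rightarrow> 'h \<Rightarrow> ('h \<Rightarrow> 'h) \<Rightarrow> bool" where
  "gaussian_measure \<mu> m C \<longleftrightarrow>
     prob_space \<mu> \<and> sets \<mu> = sets borel \<and>
     (\<forall>h. \<exists>a s. s \<ge> 0 \<and> distr \<mu> borel (\<lambda>x. x \<bullet> h) = normal_law a s) \<and>
     (\<forall>h. (\<integral>x. x \<bullet> h \<partial>\<mu>) = m \<bullet> h) \<and>
     (\<forall>h k. (\<integral>x. ((x - m) \<bullet> h) * ((x - m) \<bullet> k) \<partial>\<mu>) = C h \<bullet> k)"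

text \<open>
  The unbounded operator \<open>\<sigma>\<^sup>-\<^sup>2 F\<^sup>* F + Cpr\<^sup>-\<^sup>1\<close> has domain \<open>range Cpr\<close>; it is inverted on that domain.
\<close>

definition post_cov ::
  "('h::real_inner \<Rightarrow> 'h) \<Rightarrow> ('h \<Rightarrow> real ^ 'd) \<Rightarrow> real \<Rightarrow> 'h \<Rightarrow> 'h" where
  "post_cov Cpr F \<sigma> = inv_into (range Cpr) (\<lambda>u. (1 / \<sigma>\<^sup>2) *\<^sub>R adjoint F (F u) + inv Cpr u)"

definition map_point ::
  "('h::real_inner \<Rightarrow> 'h) \<Rightarrow> 'h \<Rightarrow> ('h \<Rightarrow> real ^ 'd) \<Rightarrow> real \<Rightarrow> real ^ 'd \<Rightarrow> 'h" where
  "map_point Cpr mpr F \<sigma> y =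
     post_cov Cpr F \<sigma> ((1 / \<sigma>\<^sup>2) *\<^sub>R adjoint F y + inv Cpr mpr)"

definition gradient :: "('h::real_inner \<Rightarrow> real) \<Rightarrow> 'h \<Rightarrow> 'h" where
  "gradient Z x = (THE g. GDERIV Z x :> g)"

definition hessian :: "('h::real_inner \<Rightarrow> real) \<Rightarrow> 'h \<Rightarrow> 'h \<Rightarrow> 'h" where
  "hessian Z x = frechet_derivative (gradient Z) (at x)"

definition twice_differentiable :: "('h::real_inner \<Rightarrow> real) \<Rightarrow> bool" where
  "twice_differentiable Z \<longleftrightarrow>
     (\<forall>x. Z differentiable (at x)) \<and> (\<forall>x. gradient Z differentiable (at x))"

definition quad_approx :: "('h::real_inner \<Rightarrow> real) \<Rightarrow> 'h \<Rightarrow> 'h \<Rightarrow> real" where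
  "quad_approx Z mb m =
     Z mb + gradient Z mb \<bullet> (m - mb) + 1 / 2 * (hessian Z mb (m - mb) \<bullet> (m - mb))"

end

theory Submission
  imports Defs
begin

text \<open>
  Let \<open>C\<close> be the posterior covariance and \<open>T = H C H\<close>. Under the posterior with data \<open>y\<close>, the
  quadratic approximation is a constant plus a linear and a quadratic functional of the centred
  Gaussian variable \<open>\<xi> = m - map y\<close>. The linear coefficient is \<open>g + H (map y - mb)\<close>, because \<open>H\<close> is
  symmetric (\<open>second_derivative_symmetric\<close>). Odd moments of \<open>\<xi>\<close> vanish, so the two functionals are
  uncorrelated, and Isserlis' formula gives the variance of the quadratic one. Hence the posterior
  variance is (\<open>quadratic_variance\<close>)

    \<open>C (g + H (map y - mb)) \<bullet> (g + H (map y - mb)) + 1/2 tr ((C H)\<^sup>2)\<close>.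

  Only the first summand depends on \<open>y\<close>. The MAP point is \<open>map y = mpr + gain (y - F mpr)\<close> with
  \<open>gain = \<sigma>\<^sup>-\<^sup>2 C F\<^sup>*\<close> (\<open>map_point_eq\<close>); when \<open>m\<close> is drawn from the prior and \<open>y\<close> from the likelihood, it
  has mean \<open>mpr\<close> and covariance \<open>Cpr - C\<close>. The mean of a quadratic form of an affine image of a
  Gaussian variable (\<open>affine_quadratic_mean\<close>), used for the likelihood and then for the prior,
  yields, by \<open>op_trace_map_point_cov\<close>,

    \<open>C l \<bullet> l + tr ((Cpr - C) T)\<close>  with  \<open>l = g + H (mpr - mb)\<close>,

  and \<open>tr (C T) = tr ((C H)\<^sup>2)\<close> turns the total into the stated formula.

  In infinite dimension the moments of quadratic forms are limits of moments of finite sums along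
  an orthonormal sequence. Isserlis' formula for these sums leads to double series that are
  Hilbert-Schmidt inner products (\<open>hilbert_schmidt_double_sum\<close>), and they converge because the
  covariance is trace class. The fourth moment of the norm is finite for the same reason
  (\<open>integrable_norm_power4\<close>) and makes dominated convergence available. The posterior covariance is trace
  class by the Woodbury formula (\<open>post_cov_woodbury\<close>): it differs from the prior covariance by an operator
  of finite rank.
\<close>

section \<open>Adjoints in Hilbert space\<close>

text \<open>
  The functional \<open>f\<close> is represented by the minimiser of \<open>\<bar>x\<bar>\<^sup>2/2 - f x\<close>. The parallelogram law
  makes every minimising sequence Cauchy, and stationarity of the minimiser in every direction
  is the claimed identity.
\<close>

lemma riesz_representation:
  fixes f :: "'a::{real_inner, banach} \<Rightarrow> real"
  assumes f: "bounded_linear f"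
  obtains r where "\<And>x. f x = r \<bullet> x"
proof -
  interpret f: bounded_linear f by fact
  obtain K where K: "\<And>x. \<bar>f x\<bar> \<le> norm x * K" "K \<ge> 0"
    using f.nonneg_bounded by auto
  define J where "J x = (x \<bullet> x) / 2 - f x" for x
  have J_lower: "J x \<ge> - K\<^sup>2 / 2" for x
  proof -
    have "0 \<le> (norm x - K)\<^sup>2" by simp
    hence "norm x * K \<le> (norm x)\<^sup>2 / 2 + K\<^sup>2 / 2" by (simp add: power2_diff)
    thus ?thesis using K(1)[of x] unfolding J_def dot_square_norm by linarith
  qed
  have bdd: "bdd_below (range J)" using J_lower by (auto intro!: bdd_belowI)
  define i where "i = Inf (range J)"
  have i_le: "i \<le> J x" for x unfolding i_def by (rule cINF_lower[OF bdd]) simp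
  have "\<exists>x. J x < i + 1 / real (Suc n)" for n
  proof -
    have "\<exists>y\<in>range J. y < i + 1 / real (Suc n)"
      by (rule cInf_lessD) (auto simp: i_def)
    thus ?thesis by auto
  qed
  then obtain X where X: "\<And>n. J (X n) < i + 1 / real (Suc n)" by metis
  have par: "(norm (x - y))\<^sup>2 / 4 = J x + J y - 2 * J ((1/2) *\<^sub>R (x + y))" for x y
    unfolding J_def power2_norm_eq_inner
    by (simp add: f.scaleR f.add inner_diff inner_add inner_commute field_simps)
  have close: "(norm (X n - X m))\<^sup>2 \<le> 4 * (1 / real (Suc n) + 1 / real (Suc m))" for n m
  proof -
    define p q where "p = 1 / real (Suc n)" and "q = 1 / real (Suc m)"
    have "J (X n) < i + p" "J (X m) < i + q" using X by (auto simp: p_def q_def)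
    thus ?thesis
      using par[of "X n" "X m"] i_le[of "(1/2) *\<^sub>R (X n + X m)"]
      unfolding p_def[symmetric] q_def[symmetric] by argo
  qed
  have "Cauchy X"
  proof (rule metric_CauchyI)
    fix e :: real assume "e > 0"
    then obtain N where N: "inverse (real (Suc N)) < e\<^sup>2 / 8"
      using reals_Archimedean[of "e\<^sup>2 / 8"] by auto
    show "\<exists>M. \<forall>m\<ge>M. \<forall>n\<ge>M. dist (X m) (X n) < e"
    proof (intro exI allI impI)
      fix m n assume "m \<ge> N" "n \<ge> N"
      hence "1 / real (Suc m) \<le> inverse (real (Suc N))" "1 / real (Suc n) \<le> inverse (real (Suc N))"
        by (auto simp: field_simps)
      hence "(norm (X m - X n))\<^sup>2 < e\<^sup>2" using close[of m n] N by argo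
      thus "dist (X m) (X n) < e"
        using \<open>e > 0\<close> power2_less_imp_less[of "norm (X m - X n)" e] unfolding dist_norm by linarith
    qed
  qed
  then obtain r where r: "X \<longlonglongrightarrow> r" using Cauchy_convergent convergent_def by blast
  have "(\<lambda>n. J (X n)) \<longlonglongrightarrow> J r"
    unfolding J_def by (intro tendsto_intros r f.tendsto) simp_all
  moreover have "(\<lambda>n. i + 1 / real (Suc n)) \<longlonglongrightarrow> i + 0"
    by (intro tendsto_intros LIMSEQ_Suc[OF lim_1_over_n])
  ultimately have "J r \<le> i + 0"
    by (rule LIMSEQ_le) (use X less_imp_le in blast)
  hence min: "J r \<le> J x" for x using i_le[of x] by simp
  have "f y = r \<bullet> y" for y
  proof (rule ccontr)
    assume ne: "f y \<noteq> r \<bullet> y"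
    define c where "c = r \<bullet> y - f y"
    have "y \<noteq> 0" using ne f.zero by auto
    hence p: "y \<bullet> y > 0" by simp
    have "J (r + t *\<^sub>R y) = J r + t * c + t\<^sup>2 * (y \<bullet> y) / 2" for t
      unfolding J_def c_def
      by (simp add: f.add f.scaleR inner_add inner_commute field_simps power2_eq_square)
    (* t = - c / (y \<bullet> y) minimises the parabola t * c + t^2 * (y \<bullet> y) / 2 *)
    from this[of "- c / (y \<bullet> y)"] min[of "r + (- c / (y \<bullet> y)) *\<^sub>R y"]
    have "0 \<le> - c / (y \<bullet> y) * c + (- c / (y \<bullet> y))\<^sup>2 * (y \<bullet> y) / 2" by linarith
    also have "\<dots> = - (c\<^sup>2 / (2 * (y \<bullet> y)))" using p by (simp add: field_simps power2_eq_square)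
    finally have "c\<^sup>2 \<le> 0" using p by (simp add: field_simps)
    thus False using ne by (simp add: c_def)
  qed
  thus thesis by (rule that)
qed

lemma adjoint_inner:
  fixes U :: "'a::{real_inner, banach} \<Rightarrow> 'b::real_inner"
  assumes "bounded_linear U"
  shows "U x \<bullet> y = x \<bullet> adjoint U y"
proof -
  have "\<exists>r. \<forall>x. U x \<bullet> y = x \<bullet> r" for y
  proof -
    have "bounded_linear (\<lambda>x. U x \<bullet> y)"
      by (rule bounded_linear_compose[OF bounded_linear_inner_left assms])
    from riesz_representation[OF this] show ?thesis by (metis inner_commute)
  qed
  then obtain V where "\<forall>x y. U x \<bullet> y = x \<bullet> V y" by metis
  thus ?thesis using adjoint_unique[of U V] by auto
qed

lemma bounded_linear_of_adjoint_pair: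
  fixes U :: "'a::real_inner \<Rightarrow> 'b::real_inner"
  assumes U: "bounded_linear U" and ad: "\<And>x y. U x \<bullet> y = x \<bullet> V y"
  shows "bounded_linear V"
proof -
  interpret U: bounded_linear U by fact
  obtain K where K: "\<And>x. norm (U x) \<le> norm x * K" "K \<ge> 0" using U.nonneg_bounded by auto
  have eqI: "v = w" if "\<And>x. x \<bullet> v = x \<bullet> w" for v w :: 'a
    using that[of "v - w"] by (metis inner_eq_zero_iff inner_diff_right right_minus_eq)
  show ?thesis
  proof (rule bounded_linear_intro[of _ K])
    show "V (x + y) = V x + V y" for x y
      by (rule eqI) (metis ad inner_add_right)
    show "V (c *\<^sub>R x) = c *\<^sub>R V x" for c x
      by (rule eqI) (metis ad inner_scaleR_right)
    show "norm (V y) \<le> norm y * K" for y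
    proof (cases "V y = 0")
      case False
      have "norm (V y) * norm (V y) = U (V y) \<bullet> y"
        by (simp add: ad norm_eq_sqrt_inner)
      also have "\<dots> \<le> norm (U (V y)) * norm y" by (rule norm_cauchy_schwarz)
      also have "\<dots> \<le> norm (V y) * K * norm y" by (intro mult_right_mono K) auto
      finally show ?thesis using False by (simp add: mult.assoc mult.commute)
    qed (simp add: K)
  qed
qed

lemma bounded_linear_adjoint:
  fixes U :: "'a::{real_inner, banach} \<Rightarrow> 'b::real_inner"
  assumes "bounded_linear U"
  shows "bounded_linear (adjoint U)"
  using bounded_linear_of_adjoint_pair[OF assms adjoint_inner[OF assms]] .

lemma adjoint_inner':
  fixes U :: "'a::{real_inner, banach} \<Rightarrow> 'b::real_inner"
  assumes "bounded_linear U"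
  shows "adjoint U y \<bullet> x = y \<bullet> U x"
  using adjoint_inner[OF assms, of x y] by (simp add: inner_commute)

section \<open>Orthonormal bases and Parseval's identity\<close>

text \<open>
  The squared distance from \<open>x\<close> to its projection onto the span of a finite \<open>S \<subseteq> B\<close> is the norm
  defect \<open>\<bar>x\<bar>\<^sup>2 - (\<Sum>e\<in>S. (x \<bullet> e)\<^sup>2)\<close>. Density of the span makes it small, because the
  projection is the best approximation of \<open>x\<close> from that span.
\<close>

lemma orthonormal_basis_parseval_norm:
  fixes B :: "'a::real_inner set"
  assumes B: "orthonormal_basis B"
  shows "((\<lambda>e. (x \<bullet> e)\<^sup>2) has_sum (norm x)\<^sup>2) B"
proof -
  have on: "e \<bullet> f = (if e = f then 1 else 0)" if "e \<in> B" "f \<in> B" for e f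
    using B that unfolding orthonormal_basis_def by (auto simp: norm_eq_1)
  define P where "P S = (\<Sum>e\<in>S. (x \<bullet> e) *\<^sub>R e)" for S
  have Pe: "P S \<bullet> e = x \<bullet> e" if "finite S" "S \<subseteq> B" "e \<in> S" for S e
  proof -
    have "P S \<bullet> e = (\<Sum>f\<in>S. if f = e then x \<bullet> e else 0)"
      unfolding P_def inner_sum_left
    proof (rule sum.cong)
      fix f assume "f \<in> S"
      thus "(x \<bullet> f) *\<^sub>R f \<bullet> e = (if f = e then x \<bullet> e else 0)"
        using on[of f e] that by (auto simp: subset_iff)
    qed simp
    thus ?thesis using that by simp
  qed
  have PP: "P S \<bullet> P S = (\<Sum>e\<in>S. (x \<bullet> e)\<^sup>2)" "x \<bullet> P S = (\<Sum>e\<in>S. (x \<bullet> e)\<^sup>2)"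
    if "finite S" "S \<subseteq> B" for S
  proof -
    have "P S \<bullet> P S = (\<Sum>e\<in>S. (x \<bullet> e) * (P S \<bullet> e))"
      by (subst (2) P_def) (simp add: inner_sum_right)
    also have "\<dots> = (\<Sum>e\<in>S. (x \<bullet> e)\<^sup>2)"
      by (rule sum.cong) (use Pe that in \<open>auto simp: power2_eq_square\<close>)
    finally show "P S \<bullet> P S = (\<Sum>e\<in>S. (x \<bullet> e)\<^sup>2)" .
    show "x \<bullet> P S = (\<Sum>e\<in>S. (x \<bullet> e)\<^sup>2)"
      unfolding P_def by (simp add: inner_sum_right power2_eq_square)
  qed
  have res: "(norm (x - P S))\<^sup>2 = (norm x)\<^sup>2 - (\<Sum>e\<in>S. (x \<bullet> e)\<^sup>2)"
    if "finite S" "S \<subseteq> B" for S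
    unfolding power2_norm_eq_inner using PP[OF that]
    by (simp add: inner_diff inner_commute)
  have bessel: "(\<Sum>e\<in>S. (x \<bullet> e)\<^sup>2) \<le> (norm x)\<^sup>2" if "finite S" "S \<subseteq> B" for S
    using res[OF that] zero_le_power2[of "norm (x - P S)"] by linarith
  show ?thesis unfolding has_sum_def tendsto_iff eventually_finite_subsets_at_top
  proof (intro allI impI)
    fix \<epsilon> :: real assume "\<epsilon> > 0"
    hence "sqrt \<epsilon> > 0" by simp
    moreover have "x \<in> closure (span B)" using B by (simp add: orthonormal_basis_def)
    ultimately obtain y where y: "y \<in> span B" "dist y x < sqrt \<epsilon>"
      by (metis closure_approachable)
    from y(1) obtain S c where S: "finite S" "S \<subseteq> B" "y = (\<Sum>e\<in>S. c e *\<^sub>R e)"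
      unfolding span_explicit by auto
    have "dist (\<Sum>e\<in>S'. (x \<bullet> e)\<^sup>2) ((norm x)\<^sup>2) < \<epsilon>"
      if S': "finite S'" "S \<subseteq> S'" "S' \<subseteq> B" for S'
    proof -
      have orth: "(x - P S') \<bullet> e = 0" if "e \<in> S'" for e
        using Pe[OF S'(1,3) that] by (simp add: inner_diff)
      have "(x - P S') \<bullet> y = 0"
        unfolding S(3) inner_sum_right using orth S'(2) by (auto intro!: sum.neutral)
      moreover have "(x - P S') \<bullet> P S' = 0"
        by (subst (2) P_def) (use orth in \<open>simp add: inner_sum_right\<close>)
      ultimately have "(x - P S') \<bullet> (P S' - y) = 0" by (simp add: inner_diff)
      hence "(norm (x - y))\<^sup>2 = (norm (x - P S'))\<^sup>2 + (norm (P S' - y))\<^sup>2"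
        unfolding power2_norm_eq_inner
        by (simp add: inner_diff inner_commute algebra_simps)
      moreover have "(norm (x - y))\<^sup>2 < \<epsilon>"
        using y(2) \<open>\<epsilon> > 0\<close> real_less_rsqrt
        by (metis dist_commute dist_norm norm_ge_zero real_sqrt_less_iff real_sqrt_unique)
      ultimately have "(norm (x - P S'))\<^sup>2 < \<epsilon>"
        using zero_le_power2[of "norm (P S' - y)"] by linarith
      thus ?thesis using res[OF S'(1,3)] bessel[OF S'(1,3)] by (simp add: dist_real_def)
    qed
    thus "\<exists>X. finite X \<and> X \<subseteq> B \<and>
      (\<forall>Y. finite Y \<and> X \<subseteq> Y \<and> Y \<subseteq> B \<longrightarrow> dist (\<Sum>e\<in>Y. (x \<bullet> e)\<^sup>2) ((norm x)\<^sup>2) < \<epsilon>)"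
      using S by blast
  qed
qed

lemma orthonormal_basis_parseval:
  fixes B :: "'a::real_inner set"
  assumes B: "orthonormal_basis B"
  shows "((\<lambda>e. (x \<bullet> e) * (y \<bullet> e)) has_sum (x \<bullet> y)) B"
proof -
  note P = orthonormal_basis_parseval_norm[OF B]
  have "((\<lambda>e. 1/4 * (((x + y) \<bullet> e)\<^sup>2 + - (((x - y) \<bullet> e)\<^sup>2))) has_sum
     (1/4 * ((norm (x + y))\<^sup>2 + - (norm (x - y))\<^sup>2))) B"
    by (intro has_sum_cmult_right has_sum_add P) (simp add: has_sum_uminus P)
  also have "1/4 * ((norm (x + y))\<^sup>2 + - (norm (x - y))\<^sup>2) = x \<bullet> y"
    unfolding power2_norm_eq_inner by (simp add: inner_add inner_diff inner_commute)
  also have "(\<lambda>e. 1/4 * (((x + y) \<bullet> e)\<^sup>2 + - (((x - y) \<bullet> e)\<^sup>2))) = (\<lambda>e. (x \<bullet> e) * (y \<bullet> e))"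
    by (auto simp: fun_eq_iff inner_add inner_diff power2_eq_square field_simps)
  finally show ?thesis .
qed

lemma sum_abs_coefficients_le:
  fixes e :: "'i \<Rightarrow> 'a::real_inner"
  assumes bessel: "\<And>x. (\<Sum>i\<in>I. (x \<bullet> e i)\<^sup>2) \<le> (norm x)\<^sup>2"
  shows "(\<Sum>i\<in>I. \<bar>(x \<bullet> e i) * (y \<bullet> e i)\<bar>) \<le> norm x * norm y"
proof -
  have "(\<Sum>i\<in>I. \<bar>(x \<bullet> e i) * (y \<bullet> e i)\<bar>) = (\<Sum>i\<in>I. \<bar>x \<bullet> e i\<bar> * \<bar>y \<bullet> e i\<bar>)"
    by (simp add: abs_mult)
  also have "\<dots> \<le> L2_set (\<lambda>i. x \<bullet> e i) I * L2_set (\<lambda>i. y \<bullet> e i) I"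
    by (rule L2_set_mult_ineq)
  also have "\<dots> \<le> norm x * norm y"
    unfolding L2_set_def by (intro mult_mono real_le_lsqrt bessel sum_nonneg) (auto simp: sum_nonneg)
  finally show ?thesis .
qed

lemma orthonormal_basis_Basis: "orthonormal_basis (Basis :: 'a::euclidean_space set)"
  unfolding orthonormal_basis_def by (simp add: inner_Basis)

text \<open>
  If the \<open>n\<close>-th vector depends on its predecessors, the residual vanishes and
  \<open>sgn 0 = 0\<close> enters the sequence. So the result consists of orthonormal vectors and zeros.
\<close>

fun gram_schmidt :: "(nat \<Rightarrow> 'a::real_inner) \<Rightarrow> nat \<Rightarrow> 'a" where
  "gram_schmidt d n = sgn (d n - (\<Sum>k<n. (d n \<bullet> gram_schmidt d k) *\<^sub>R gram_schmidt d k))"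

declare gram_schmidt.simps [simp del]

lemma gram_schmidt_self: "gram_schmidt d n \<bullet> gram_schmidt d n = (if gram_schmidt d n = 0 then 0 else 1)"
  by (subst (1 2 3) gram_schmidt.simps) (auto simp: sgn_zero_iff dot_square_norm norm_sgn)

lemma gram_schmidt_orthogonal:
  assumes "j \<noteq> n"
  shows "gram_schmidt d n \<bullet> gram_schmidt d j = 0"
proof -
  have "gram_schmidt d n \<bullet> gram_schmidt d j = 0" if "j < n" for n j
    using that
  proof (induction n arbitrary: j rule: less_induct)
    case (less n)
    let ?e = "gram_schmidt d"
    let ?r = "d n - (\<Sum>k<n. (d n \<bullet> ?e k) *\<^sub>R ?e k)"
    have orth: "?e k \<bullet> ?e j = 0" if "k < n" "k \<noteq> j" for k
    proof (cases "k < j")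
      case True
      thus ?thesis using less.IH[of j k] less.prems by (simp add: inner_commute)
    next
      case False
      thus ?thesis using less.IH[of k j] that by simp
    qed
    have "(\<Sum>k<n. (d n \<bullet> ?e k) *\<^sub>R ?e k) \<bullet> ?e j = (\<Sum>k<n. if k = j then (d n \<bullet> ?e j) * (?e j \<bullet> ?e j) else 0)"
      unfolding inner_sum_left by (rule sum.cong) (use orth in auto)
    also have "\<dots> = (d n \<bullet> ?e j) * (?e j \<bullet> ?e j)" using less.prems by simp
    also have "\<dots> = d n \<bullet> ?e j" by (simp add: gram_schmidt_self)
    finally have "?r \<bullet> ?e j = 0" by (simp add: inner_diff_left)
    thus ?case by (subst gram_schmidt.simps) (simp add: sgn_div_norm)
  qed
  from this[of j n] this[of n j] assms show ?thesis
    by (metis inner_commute linorder_neqE_nat)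
qed

text \<open>
  Gram-Schmidt is applied to a countable dense set, which separability provides; it stays inside
  the span of the result.
\<close>

lemma orthonormal_sequence_exists:
  obtains e :: "nat \<Rightarrow> 'a::{real_inner, second_countable_topology}"
  where "orthonormal_basis (range e - {0})" "inj_on e {n. e n \<noteq> 0}"
proof -
  obtain D :: "'a set" where D: "countable D" "\<And>X. open X \<Longrightarrow> X \<noteq> {} \<Longrightarrow> \<exists>d\<in>D. d \<in> X"
    using countable_dense_setE by metis
  have Dne: "D \<noteq> {}" using D(2)[of UNIV] by auto
  define d where "d = from_nat_into D"
  have rd: "range d = D" unfolding d_def by (rule range_from_nat_into[OF Dne D(1)])
  define e where "e = gram_schmidt d"
  have sp: "d n \<in> span (range e - {0})" for n
  proof -
    let ?r = "d n - (\<Sum>k<n. (d n \<bullet> e k) *\<^sub>R e k)"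
    have el: "e k \<in> span (range e - {0})" for k
      by (cases "e k = 0") (auto intro: span_zero span_base)
    have "e n = sgn ?r" unfolding e_def by (subst gram_schmidt.simps) simp
    hence "?r = norm ?r *\<^sub>R e n" by (cases "?r = 0") (simp_all add: sgn_div_norm)
    hence "d n = norm ?r *\<^sub>R e n + (\<Sum>k<n. (d n \<bullet> e k) *\<^sub>R e k)" by simp
    also have "\<dots> \<in> span (range e - {0})"
      by (intro span_add span_scale span_sum el)
    finally show ?thesis .
  qed
  have "closure (span (range e - {0})) = UNIV"
  proof -
    have "closure D = UNIV"
    proof -
      have "x \<in> closure D" for x
        unfolding closure_iff_nhds_not_empty
        by (metis D(2) disjoint_iff empty_iff interior_subset open_interior subsetD)
      thus ?thesis by auto
    qed
    moreover have "D \<subseteq> span (range e - {0})" using sp rd by auto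
    ultimately show ?thesis using closure_mono by blast
  qed
  moreover have "norm (e n) = 1" if "e n \<noteq> 0" for n
    using that gram_schmidt_self[of d n] by (simp add: e_def norm_eq_1)
  moreover have "e n \<bullet> e k = 0" if "e n \<noteq> e k" for n k
    using that gram_schmidt_orthogonal[of k n d] by (cases "n = k") (auto simp: e_def)
  ultimately have "orthonormal_basis (range e - {0})"
    unfolding orthonormal_basis_def by auto
  moreover have "inj_on e {n. e n \<noteq> 0}"
  proof (rule inj_onI, rule ccontr)
    fix n k assume "n \<in> {n. e n \<noteq> 0}" "e n = e k" "n \<noteq> k"
    thus False using gram_schmidt_orthogonal[of k n d] by (auto simp: e_def)
  qed
  ultimately show thesis by (rule that)
qed

lemma has_sum_orthonormal_sequence:
  fixes f :: "'a::real_vector \<Rightarrow> real" and e :: "nat \<Rightarrow> 'a"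
  assumes s: "(f has_sum t) (range e - {0})" and inj: "inj_on e {n. e n \<noteq> 0}" and f0: "f 0 = 0"
  shows "(\<lambda>n. f (e n)) sums t"
proof -
  have eq: "range e - {0} = e ` {n. e n \<noteq> 0}" by auto
  have "((\<lambda>n. f (e n)) has_sum t) {n. e n \<noteq> 0}"
    using s inj unfolding eq by (simp add: has_sum_reindex o_def)
  hence "((\<lambda>n. f (e n)) has_sum t) UNIV"
    by (rule has_sum_cong_neutral[THEN iffD1, rotated -1]) (auto simp: f0)
  thus ?thesis by (rule has_sum_imp_sums)
qed

section \<open>Trace class operators\<close>

text \<open>
  The property that \<^const>\<open>op_trace\<close> selects by definite description. Working with it directly gives
  linearity without any uniqueness argument.
\<close>

definition has_trace :: "('a::real_inner \<Rightarrow> 'a) \<Rightarrow> real \<Rightarrow> bool" where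
  "has_trace T t \<longleftrightarrow> (\<forall>B. orthonormal_basis B \<longrightarrow> ((\<lambda>e. T e \<bullet> e) has_sum t) B)"

lemma op_trace_eqI:
  fixes T :: "'a::{real_inner, second_countable_topology} \<Rightarrow> 'a"
  assumes "has_trace T t"
  shows "op_trace T = t"
proof -
  obtain e :: "nat \<Rightarrow> 'a" where e: "orthonormal_basis (range e - {0})"
    using orthonormal_sequence_exists by metis
  show ?thesis unfolding op_trace_def has_trace_def[symmetric]
  proof (rule the_equality)
    fix s assume "has_trace T s"
    thus "s = t" using assms e unfolding has_trace_def by (meson has_sum_unique)
  qed fact
qed

lemma has_trace_add:
  "has_trace S s \<Longrightarrow> has_trace T t \<Longrightarrow> has_trace (\<lambda>x. S x + T x) (s + t)"
  unfolding has_trace_def by (auto simp: inner_add_left intro: has_sum_add)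

lemma has_trace_scaleR: "has_trace T t \<Longrightarrow> has_trace (\<lambda>x. c *\<^sub>R T x) (c * t)"
  unfolding has_trace_def by (auto intro: has_sum_cmult_right)

lemma has_trace_diff:
  assumes "has_trace S s" "has_trace T t"
  shows "has_trace (\<lambda>x. S x - T x) (s - t)"
  using has_trace_add[OF assms(1) has_trace_scaleR[OF assms(2), of "-1"]] by simp

lemma has_trace_rank_one:
  fixes a b :: "'a::real_inner"
  shows "has_trace (\<lambda>x. (a \<bullet> x) *\<^sub>R b) (a \<bullet> b)"
  unfolding has_trace_def by (auto intro: orthonormal_basis_parseval)

lemma has_trace_finite_rank:
  fixes a b :: "'i \<Rightarrow> 'a::real_inner"
  assumes "finite I"
  shows "has_trace (\<lambda>x. \<Sum>i\<in>I. (a i \<bullet> x) *\<^sub>R b i) (\<Sum>i\<in>I. a i \<bullet> b i)"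
  using assms
proof induction
  case empty
  show ?case by (simp add: has_trace_def)
next
  case (insert i I)
  thus ?case using has_trace_add[OF has_trace_rank_one[of "a i" "b i"] insert.IH] by simp
qed

text \<open>
  The trace of a nuclear series is computed term by term: the double series of
  \<open>(a n \<bullet> e) * (b n \<bullet> e)\<close> over \<open>n\<close> and \<open>e\<close> converges absolutely, so its two iterated sums agree.
  Summing over \<open>e\<close> first gives a value that does not mention the basis.
\<close>

lemma has_trace_nuclear:
  fixes T :: "'a::real_inner \<Rightarrow> 'a"
  assumes ab: "summable (\<lambda>n. norm (a n) * norm (b n))"
    and T: "\<And>x. (\<lambda>n. (a n \<bullet> x) *\<^sub>R b n) sums T x"
  shows "has_trace T (\<Sum>n. a n \<bullet> b n)"
  unfolding has_trace_def
proof (intro allI impI)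
  fix B :: "'a set" assume B: "orthonormal_basis B"
  define f where "f = (\<lambda>(n, e). (a n \<bullet> e) * (b n \<bullet> e))"
  have inner_bound: "(\<Sum>e\<in>S. \<bar>(x \<bullet> e) * (y \<bullet> e)\<bar>) \<le> norm x * norm y"
    if "finite S" "S \<subseteq> B" for S and x y :: 'a
    by (intro sum_abs_coefficients_le finite_sum_le_has_sum[OF orthonormal_basis_parseval_norm[OF B]])
       (use that in auto)
  have row_summable: "(\<lambda>e. norm (f (n, e))) summable_on B" for n
    by (rule nonneg_bdd_above_summable_on)
       (auto simp: f_def intro!: bdd_aboveI2 inner_bound)
  have row_le: "infsum (\<lambda>e. norm (f (n, e))) B \<le> norm (a n) * norm (b n)" for n
    by (rule infsum_le_finite_sums[OF row_summable]) (auto simp: f_def intro!: inner_bound)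
  have "(\<lambda>n. norm (infsum (\<lambda>e. norm (f (n, e))) B)) summable_on UNIV"
    by (rule Infinite_Sum.abs_summable_on_comparison_test[where g = "\<lambda>n. norm (a n) * norm (b n)"])
       (use ab row_le infsum_nonneg in \<open>auto intro!: norm_summable_imp_summable_on simp: abs_mult infsum_nonneg\<close>)
  hence "(\<lambda>p. norm (f p)) summable_on UNIV \<times> B"
    unfolding Infinite_Sum.abs_summable_on_Sigma_iff using row_summable by simp
  hence "f summable_on UNIV \<times> B" by (rule Infinite_Sum.abs_summable_summable)
  then obtain S where S: "(f has_sum S) (UNIV \<times> B)" by (auto simp: summable_on_def)
  have "((\<lambda>n. a n \<bullet> b n) has_sum S) UNIV"
    by (rule has_sum_SigmaD[OF S]) (use orthonormal_basis_parseval[OF B] in \<open>auto simp: f_def\<close>)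
  hence S_eq: "S = (\<Sum>n. a n \<bullet> b n)" by (simp add: has_sum_imp_sums sums_unique)
  have "((\<lambda>(e, n). f (n, e)) has_sum S) (B \<times> UNIV)"
    using S by (subst (asm) has_sum_swap) simp
  moreover have "((\<lambda>n. f (n, e)) has_sum (T e \<bullet> e)) UNIV" if "e \<in> B" for e
  proof (rule norm_summable_imp_has_sum)
    have "(\<lambda>n. ((a n \<bullet> e) *\<^sub>R b n) \<bullet> e) sums (T e \<bullet> e)"
      by (rule bounded_linear.sums[OF bounded_linear_inner_left T])
    thus "(\<lambda>n. f (n, e)) sums (T e \<bullet> e)" by (simp add: f_def)
    have ne: "norm e = 1" using B that by (simp add: orthonormal_basis_def)
    show "summable (\<lambda>n. norm (f (n, e)))"
    proof (rule summable_comparison_test'[OF ab])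
      show "norm (norm (f (n, e))) \<le> norm (a n) * norm (b n)" for n
        using mult_mono[OF Cauchy_Schwarz_ineq2[of "a n" e] Cauchy_Schwarz_ineq2[of "b n" e]]
        by (simp add: f_def abs_mult ne)
    qed
  qed
  ultimately have "((\<lambda>e. T e \<bullet> e) has_sum S) B"
    by (intro has_sum_SigmaD[where f = "\<lambda>(e, n). f (n, e)" and B = "\<lambda>_. UNIV"]) auto
  thus "((\<lambda>e. T e \<bullet> e) has_sum (\<Sum>n. a n \<bullet> b n)) B" by (simp add: S_eq)
qed

lemma trace_class_opE:
  assumes "trace_class_op T"
  obtains a b where "summable (\<lambda>n. norm (a n) * norm (b n))"
    and "\<And>x. (\<lambda>n. (a n \<bullet> x) *\<^sub>R b n) sums T x"
  using assms unfolding trace_class_op_def by blast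

lemma trace_class_bounded_linear: "trace_class_op T \<Longrightarrow> bounded_linear T"
  by (simp add: trace_class_op_def)

lemma trace_class_has_trace:
  fixes T :: "'a::{real_inner, second_countable_topology} \<Rightarrow> 'a"
  assumes "trace_class_op T"
  shows "has_trace T (op_trace T)"
proof -
  obtain a b where "summable (\<lambda>n. norm (a n) * norm (b n))"
    and "\<And>x. (\<lambda>n. (a n \<bullet> x) *\<^sub>R b n) sums T x"
    by (rule trace_class_opE[OF assms]) (rule that)
  hence "has_trace T (\<Sum>n. a n \<bullet> b n)" by (rule has_trace_nuclear)
  thus ?thesis by (simp add: op_trace_eqI)
qed

lemma nuclear_comp_left:
  assumes ab: "summable (\<lambda>n. norm (a n) * norm (b n))"
    and T: "\<And>x. (\<lambda>n. (a n \<bullet> x) *\<^sub>R b n) sums T x" and S: "bounded_linear S"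
  shows "summable (\<lambda>n. norm (a n) * norm (S (b n)))"
    and "(\<lambda>n. (a n \<bullet> x) *\<^sub>R S (b n)) sums S (T x)"
proof -
  obtain K where K: "\<And>x. norm (S x) \<le> norm x * K" using S bounded_linear.bounded by blast
  show "summable (\<lambda>n. norm (a n) * norm (S (b n)))"
    by (rule summable_comparison_test'[OF summable_mult2[OF ab, of K]])
       (use K in \<open>auto simp: mult.assoc intro!: mult_left_mono\<close>)
  show "(\<lambda>n. (a n \<bullet> x) *\<^sub>R S (b n)) sums S (T x)"
    using bounded_linear.sums[OF S T[of x]] by (simp add: linear_simps[OF S])
qed

lemma nuclear_comp_right:
  fixes S :: "'a::{real_inner, banach} \<Rightarrow> 'a"
  assumes ab: "summable (\<lambda>n. norm (a n) * norm (b n))"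
    and T: "\<And>x. (\<lambda>n. (a n \<bullet> x) *\<^sub>R b n) sums T x" and S: "bounded_linear S"
  shows "summable (\<lambda>n. norm (adjoint S (a n)) * norm (b n))"
    and "(\<lambda>n. (adjoint S (a n) \<bullet> x) *\<^sub>R b n) sums T (S x)"
proof -
  obtain K where K: "\<And>x. norm (adjoint S x) \<le> norm x * K"
    using bounded_linear_adjoint[OF S] bounded_linear.bounded by blast
  show "summable (\<lambda>n. norm (adjoint S (a n)) * norm (b n))"
  proof (rule summable_comparison_test'[OF summable_mult2[OF ab, of K]])
    show "norm (norm (adjoint S (a n)) * norm (b n)) \<le> norm (a n) * norm (b n) * K" for n
      using mult_right_mono[OF K norm_ge_zero, of "a n" "b n"] by (simp add: algebra_simps)
  qed
  show "(\<lambda>n. (adjoint S (a n) \<bullet> x) *\<^sub>R b n) sums T (S x)"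
    using T[of "S x"] by (simp add: adjoint_inner'[OF S])
qed

lemma trace_class_comp_left:
  fixes T S :: "'a::real_inner \<Rightarrow> 'a"
  assumes T: "trace_class_op T" and S: "bounded_linear S"
  shows "trace_class_op (\<lambda>x. S (T x))"
proof -
  obtain a b where ab: "summable (\<lambda>n. norm (a n) * norm (b n))"
    "\<And>x. (\<lambda>n. (a n \<bullet> x) *\<^sub>R b n) sums T x"
    by (rule trace_class_opE[OF T]) (rule that)
  show ?thesis unfolding trace_class_op_def
    by (intro conjI exI[of _ a] exI[of _ "\<lambda>n. S (b n)"] allI nuclear_comp_left[OF ab S]
        bounded_linear_compose[OF S trace_class_bounded_linear[OF T]])
qed

lemma trace_class_comp_right:
  fixes T S :: "'a::{real_inner, banach} \<Rightarrow> 'a"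
  assumes T: "trace_class_op T" and S: "bounded_linear S"
  shows "trace_class_op (\<lambda>x. T (S x))"
proof -
  obtain a b where ab: "summable (\<lambda>n. norm (a n) * norm (b n))"
    "\<And>x. (\<lambda>n. (a n \<bullet> x) *\<^sub>R b n) sums T x"
    by (rule trace_class_opE[OF T]) (rule that)
  show ?thesis unfolding trace_class_op_def
    by (intro conjI exI[of _ "\<lambda>n. adjoint S (a n)"] exI[of _ b] allI nuclear_comp_right[OF ab S]
        bounded_linear_compose[OF trace_class_bounded_linear[OF T] S])
qed

text \<open>
  Both traces are \<open>\<Sum>n. a n \<bullet> S (b n)\<close> for a nuclear series of \<open>T\<close>: in one product \<open>S\<close> acts on
  \<open>b n\<close>, in the other its adjoint acts on \<open>a n\<close>.
\<close>

lemma op_trace_commute: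
  fixes T S :: "'a::{real_inner, banach, second_countable_topology} \<Rightarrow> 'a"
  assumes T: "trace_class_op T" and S: "bounded_linear S"
  shows "op_trace (\<lambda>x. S (T x)) = op_trace (\<lambda>x. T (S x))"
proof -
  obtain a b where ab: "summable (\<lambda>n. norm (a n) * norm (b n))"
    "\<And>x. (\<lambda>n. (a n \<bullet> x) *\<^sub>R b n) sums T x"
    by (rule trace_class_opE[OF T]) (rule that)
  have "op_trace (\<lambda>x. S (T x)) = (\<Sum>n. a n \<bullet> S (b n))"
    by (intro op_trace_eqI has_trace_nuclear nuclear_comp_left[OF ab S])
  moreover have "op_trace (\<lambda>x. T (S x)) = (\<Sum>n. adjoint S (a n) \<bullet> b n)"
    by (intro op_trace_eqI has_trace_nuclear nuclear_comp_right[OF ab S])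
  ultimately show ?thesis by (simp add: adjoint_inner'[OF S])
qed

lemma trace_class_add_rank_one:
  fixes T :: "'a::real_inner \<Rightarrow> 'a"
  assumes T: "trace_class_op T"
  shows "trace_class_op (\<lambda>x. T x + (u \<bullet> x) *\<^sub>R v)"
proof -
  obtain a b where ab: "summable (\<lambda>n. norm (a n) * norm (b n))"
    and Tx: "\<And>x. (\<lambda>n. (a n \<bullet> x) *\<^sub>R b n) sums T x"
    by (rule trace_class_opE[OF T]) (rule that)
  note bl = trace_class_bounded_linear[OF T]
  define a' where "a' = case_nat u a"
  define b' where "b' = case_nat v b"
  have "summable (\<lambda>n. norm (a' n) * norm (b' n))"
    by (subst summable_Suc_iff[symmetric]) (use ab in \<open>simp add: a'_def b'_def\<close>)
  moreover have "(\<lambda>n. (a' n \<bullet> x) *\<^sub>R b' n) sums (T x + (u \<bullet> x) *\<^sub>R v)" for x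
    using sums_Suc[of "\<lambda>n. (a' n \<bullet> x) *\<^sub>R b' n" "T x"] Tx[of x] by (simp add: a'_def b'_def)
  moreover have "bounded_linear (\<lambda>x. T x + (u \<bullet> x) *\<^sub>R v)"
    by (intro bounded_linear_add bl bounded_linear_compose[OF bounded_linear_scaleR_left]
        bounded_linear_inner_right)
  ultimately show ?thesis unfolding trace_class_op_def by blast
qed

lemma trace_class_add_finite_rank:
  fixes T :: "'a::real_inner \<Rightarrow> 'a"
  assumes T: "trace_class_op T" and "finite I"
  shows "trace_class_op (\<lambda>x. T x + (\<Sum>i\<in>I. (u i \<bullet> x) *\<^sub>R v i))"
  using assms(2)
proof induction
  case empty
  show ?case using T by simp
next
  case (insert i I)
  thus ?case using trace_class_add_rank_one[OF insert.IH, of "u i" "v i"]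
    by (simp add: algebra_simps)
qed

lemma trace_class_finite_rank:
  fixes u v :: "'i \<Rightarrow> 'a::real_inner"
  assumes "finite I"
  shows "trace_class_op (\<lambda>x. \<Sum>i\<in>I. (u i \<bullet> x) *\<^sub>R v i)"
proof -
  have "trace_class_op (\<lambda>x::'a. 0::'a)"
    unfolding trace_class_op_def
    by (intro conjI exI[of _ "\<lambda>_. 0"]) auto
  from trace_class_add_finite_rank[OF this assms, of u v] show ?thesis by simp
qed

lemma trace_class_scaleR_euclidean:
  "trace_class_op (\<lambda>x :: 'a::euclidean_space. c *\<^sub>R x)"
proof -
  have "(\<Sum>i\<in>Basis. ((c *\<^sub>R i) \<bullet> x) *\<^sub>R i) = c *\<^sub>R x" for x :: 'a
  proof -
    have "(\<Sum>i\<in>Basis. ((c *\<^sub>R i) \<bullet> x) *\<^sub>R i) = c *\<^sub>R (\<Sum>i\<in>Basis. (x \<bullet> i) *\<^sub>R i)"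
      by (simp add: scaleR_sum_right inner_commute)
    thus ?thesis by (simp only: euclidean_representation)
  qed
  thus ?thesis using trace_class_finite_rank[OF finite_Basis, of "\<lambda>i. c *\<^sub>R i" "\<lambda>i::'a. i"] by simp
qed

lemma op_trace_euclidean:
  fixes T :: "'a::euclidean_space \<Rightarrow> 'a"
  assumes "trace_class_op T"
  shows "op_trace T = (\<Sum>i\<in>Basis. T i \<bullet> i)"
  using trace_class_has_trace[OF assms] orthonormal_basis_Basis has_sum_finite[OF finite_Basis]
  unfolding has_trace_def by (metis has_sum_unique)

section \<open>Traces along an orthonormal sequence\<close>

text \<open>
  Limit theorems for integrals need sums along a sequence, whereas an orthonormal basis is a set.
  The two properties below express the same facts as sums along a sequence. They tolerate zeros, so
  a Gram-Schmidt sequence has them also in finite dimension.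
\<close>

definition parseval_sequence :: "(nat \<Rightarrow> 'a::real_inner) \<Rightarrow> bool" where
  "parseval_sequence e \<longleftrightarrow> (\<forall>x y. (\<lambda>n. (x \<bullet> e n) * (y \<bullet> e n)) sums (x \<bullet> y)) \<and>
     (\<forall>T t. bounded_linear T \<longrightarrow> has_trace T t \<longrightarrow> (\<lambda>n. T (e n) \<bullet> e n) sums t)"

lemma parseval_sequence_exists:
  obtains e :: "nat \<Rightarrow> 'a::{real_inner, second_countable_topology}" where "parseval_sequence e"
proof -
  obtain e :: "nat \<Rightarrow> 'a" where e: "orthonormal_basis (range e - {0})" "inj_on e {n. e n \<noteq> 0}"
    by (rule orthonormal_sequence_exists)
  have "(\<lambda>n. (x \<bullet> e n) * (y \<bullet> e n)) sums (x \<bullet> y)" for x y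
    by (rule has_sum_orthonormal_sequence[OF orthonormal_basis_parseval[OF e(1)] e(2)]) simp
  moreover have "(\<lambda>n. T (e n) \<bullet> e n) sums t" if "has_trace T t" for T t
    by (rule has_sum_orthonormal_sequence[OF _ e(2)])
       (use that e(1) in \<open>auto simp: has_trace_def\<close>)
  ultimately show thesis using that unfolding parseval_sequence_def by blast
qed

lemma bessel_parseval_sequence:
  assumes e: "parseval_sequence e"
  shows "(\<Sum>n<N. \<bar>(x \<bullet> e n) * (y \<bullet> e n)\<bar>) \<le> norm x * norm y"
proof (rule sum_abs_coefficients_le)
  fix x
  have s: "(\<lambda>n. (x \<bullet> e n)\<^sup>2) sums (norm x)\<^sup>2"
    using e unfolding parseval_sequence_def power2_norm_eq_inner by (simp add: power2_eq_square)
  show "(\<Sum>n<N. (x \<bullet> e n)\<^sup>2) \<le> (norm x)\<^sup>2"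
    using sum_le_suminf[OF sums_summable[OF s], of "{..<N}"] sums_unique[OF s] by simp
qed

lemma parseval_sequence_trace:
  fixes T :: "'a::{real_inner, second_countable_topology} \<Rightarrow> 'a"
  assumes "parseval_sequence e" "trace_class_op T"
  shows "(\<lambda>n. T (e n) \<bullet> e n) sums op_trace T"
  using assms trace_class_has_trace trace_class_bounded_linear
  unfolding parseval_sequence_def by blast

text \<open>
  Trace class operators are Hilbert-Schmidt, because \<open>adjoint T \<circ> T\<close> is again trace class.
\<close>

lemma summable_hilbert_schmidt:
  fixes T :: "'a::{real_inner, banach, second_countable_topology} \<Rightarrow> 'a"
  assumes e: "parseval_sequence e" and T: "trace_class_op T"
  shows "summable (\<lambda>n. (norm (T (e n)))\<^sup>2)"
proof -
  note bl = trace_class_bounded_linear[OF T]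
  have "(\<lambda>n. adjoint T (T (e n)) \<bullet> e n) sums op_trace (\<lambda>x. adjoint T (T x))"
    by (rule parseval_sequence_trace[OF e trace_class_comp_left[OF T bounded_linear_adjoint[OF bl]]])
  thus ?thesis unfolding power2_norm_eq_inner by (simp add: adjoint_inner'[OF bl] sums_iff)
qed

text \<open>
  The Hilbert-Schmidt inner product of \<open>P\<close> and \<open>R\<close>, evaluated through the matrix entries. The
  square partial sums converge by dominated convergence for series; the Hilbert-Schmidt property
  supplies the summable bound.
\<close>

lemma hilbert_schmidt_double_sum:
  fixes P R :: "'a::{real_inner, banach, second_countable_topology} \<Rightarrow> 'a"
  assumes e: "parseval_sequence e" and P: "trace_class_op P" and R: "trace_class_op R"
  shows "(\<lambda>N. \<Sum>n<N. \<Sum>k<N. (P (e n) \<bullet> e k) * (R (e n) \<bullet> e k))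
           \<longlonglongrightarrow> op_trace (\<lambda>x. adjoint R (P x))"
proof -
  note blR = trace_class_bounded_linear[OF R]
  (* By Cauchy-Schwarz row n is at most norm (P (e n)) * norm (R (e n)), and so at most M n. *)
  define M where "M n = (norm (P (e n)))\<^sup>2 + (norm (R (e n)))\<^sup>2" for n
  have M: "summable M"
    unfolding M_def by (intro summable_add summable_hilbert_schmidt e P R)
  (* Each row is cut off at N as well, so that one limit in N handles both indices. *)
  define a where "a n N = (if n < N then \<Sum>k<N. (P (e n) \<bullet> e k) * (R (e n) \<bullet> e k) else 0)"
    for n N :: nat
  have lim: "(\<lambda>N. a n N) \<longlonglongrightarrow> P (e n) \<bullet> R (e n)" for n
  proof -
    have "(\<lambda>N. \<Sum>k<N. (P (e n) \<bullet> e k) * (R (e n) \<bullet> e k)) \<longlonglongrightarrow> P (e n) \<bullet> R (e n)"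
      using e unfolding parseval_sequence_def sums_def by blast
    moreover have "\<forall>\<^sub>F N in sequentially. (\<Sum>k<N. (P (e n) \<bullet> e k) * (R (e n) \<bullet> e k)) = a n N"
      by (rule eventually_mono[OF eventually_gt_at_top[of n]]) (simp add: a_def)
    ultimately show ?thesis by (rule Lim_transform_eventually)
  qed
  have bound: "norm (a n N) \<le> M n" for n N
  proof -
    have "\<bar>\<Sum>k<N. (P (e n) \<bullet> e k) * (R (e n) \<bullet> e k)\<bar> \<le> (\<Sum>k<N. \<bar>(P (e n) \<bullet> e k) * (R (e n) \<bullet> e k)\<bar>)"
      by (rule sum_abs)
    also have "\<dots> \<le> norm (P (e n)) * norm (R (e n))" by (rule bessel_parseval_sequence[OF e])
    also have "\<dots> \<le> M n"
      using zero_le_power2[of "norm (P (e n)) - norm (R (e n))"]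
        zero_le_power2[of "norm (P (e n)) + norm (R (e n))"]
      unfolding M_def power2_diff power2_sum by linarith
    finally have "\<bar>\<Sum>k<N. (P (e n) \<bullet> e k) * (R (e n) \<bullet> e k)\<bar> \<le> M n" .
    moreover have "0 \<le> M n" unfolding M_def by simp
    ultimately show ?thesis by (simp add: a_def)
  qed
  have "(\<lambda>N. suminf (\<lambda>n. a n N)) \<longlonglongrightarrow> (\<Sum>n. P (e n) \<bullet> R (e n))"
    using tannerys_theorem[of a, OF lim always_eventually M] bound by auto
  moreover have "suminf (\<lambda>n. a n N) = (\<Sum>n<N. \<Sum>k<N. (P (e n) \<bullet> e k) * (R (e n) \<bullet> e k))" for N
    by (subst suminf_finite[of "{..<N}"]) (auto simp: a_def)
  moreover have "(\<lambda>n. adjoint R (P (e n)) \<bullet> e n) sums op_trace (\<lambda>x. adjoint R (P x))"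
    by (rule parseval_sequence_trace[OF e trace_class_comp_left[OF P bounded_linear_adjoint[OF blR]]])
  hence "(\<Sum>n. P (e n) \<bullet> R (e n)) = op_trace (\<lambda>x. adjoint R (P x))"
    by (simp add: adjoint_inner'[OF blR] sums_iff)
  ultimately show ?thesis by simp
qed

section \<open>Moments of Gaussian measures\<close>

text \<open>
  The point mass has to be treated separately, since it has no density.
\<close>

lemma normal_law_central_moments:
  assumes s: "s \<ge> 0"
  shows "has_bochner_integral (normal_law a s) (\<lambda>x. (x - a) ^ 1) 0"
    and "has_bochner_integral (normal_law a s) (\<lambda>x. (x - a) ^ 2) (s\<^sup>2)"
    and "has_bochner_integral (normal_law a s) (\<lambda>x. (x - a) ^ 3) 0"
    and "has_bochner_integral (normal_law a s) (\<lambda>x. (x - a) ^ 4) (3 * (s\<^sup>2)\<^sup>2)"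
proof -
  have dens: "has_bochner_integral (normal_law a s) (\<lambda>x. (x - a) ^ k) v"
    if "s > 0" "has_bochner_integral lborel (\<lambda>x. normal_density a s x * (x - a) ^ k) v" for k v
    unfolding normal_law_def using that
    by (auto intro!: has_bochner_integral_density)
  have point: "has_bochner_integral (normal_law a s) (\<lambda>x. (x - a) ^ k) 0"
    if "s = 0" "k > 0" for k
  proof -
    have "AE x in return borel a. (x - a) ^ k = 0"
      using that by (subst AE_return) auto
    hence "has_bochner_integral (return borel a) (\<lambda>x. (x - a) ^ k) 0 \<longleftrightarrow>
        has_bochner_integral (return borel a) (\<lambda>x. 0 :: real) 0"
      by (intro has_bochner_integral_cong_AE) auto
    thus ?thesis using that by (simp add: normal_law_def has_bochner_integral_zero)
  qed
  have odd: "has_bochner_integral (normal_law a s) (\<lambda>x. (x - a) ^ (2 * k + 1)) 0" for k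
    using dens[OF _ normal_moment_odd, of k] point[of "2 * k + 1"] s by (cases "s = 0") auto
  show "has_bochner_integral (normal_law a s) (\<lambda>x. (x - a) ^ 1) 0"
    using odd[of 0] by simp
  show "has_bochner_integral (normal_law a s) (\<lambda>x. (x - a) ^ 3) 0"
    using odd[of 1] by simp
  have even: "has_bochner_integral (normal_law a s) (\<lambda>x. (x - a) ^ (2 * k)) (fact (2 * k) / ((2 / s\<^sup>2) ^ k * fact k))"
    if "s > 0" for k
    by (rule dens[OF that normal_moment_even[OF that]])
  show "has_bochner_integral (normal_law a s) (\<lambda>x. (x - a) ^ 2) (s\<^sup>2)"
    using even[of 1] point[of 2] s by (cases "s = 0") (auto simp: fact_numeral)
  show "has_bochner_integral (normal_law a s) (\<lambda>x. (x - a) ^ 4) (3 * (s\<^sup>2)\<^sup>2)"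
    using even[of 2] point[of 4] s
    by (cases "s = 0") (auto simp: fact_numeral power_divide)
qed

locale trace_class_gaussian =
  fixes \<mu> :: "'a::{real_inner, banach, second_countable_topology} measure" and m :: 'a and C :: "'a \<Rightarrow> 'a"
  assumes gaussian: "gaussian_measure \<mu> m C" and trace_class: "trace_class_op C"
begin

sublocale prob_space \<mu>
  using gaussian by (simp add: gaussian_measure_def)

lemma sets_eq [measurable_cong]: "sets \<mu> = sets borel"
  using gaussian by (simp add: gaussian_measure_def)

lemma has_bochner_integral_const: "has_bochner_integral \<mu> (\<lambda>x. c :: real) c"
  by (simp add: has_bochner_integral_iff prob_space)

lemma bounded_linear_cov: "bounded_linear C"
  by (rule trace_class_bounded_linear[OF trace_class])

sublocale cov: bounded_linear C by (rule bounded_linear_cov)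

lemma continuous_measurable:
  fixes f :: "'a \<Rightarrow> 'b::topological_space"
  shows "continuous_on UNIV f \<Longrightarrow> f \<in> borel_measurable \<mu>"
  using borel_measurable_continuous_onI sets_eq measurable_cong_sets by blast

text \<open>
  The definition of a Gaussian measure only states the law of each scalar \<open>x \<bullet> h\<close> as some normal
  law; its two parameters are recovered from the mean and the covariance.
\<close>

lemma central_moments:
  shows moment1: "has_bochner_integral \<mu> (\<lambda>x. (x - m) \<bullet> h) 0"
    and moment2: "has_bochner_integral \<mu> (\<lambda>x. ((x - m) \<bullet> h) ^ 2) (C h \<bullet> h)"
    and moment3: "has_bochner_integral \<mu> (\<lambda>x. ((x - m) \<bullet> h) ^ 3) 0"
    and moment4: "has_bochner_integral \<mu> (\<lambda>x. ((x - m) \<bullet> h) ^ 4) (3 * (C h \<bullet> h)\<^sup>2)"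
proof -
  obtain a s where s: "s \<ge> 0" and d: "distr \<mu> borel (\<lambda>x. x \<bullet> h) = normal_law a s"
    using gaussian unfolding gaussian_measure_def by blast
  have meas: "(\<lambda>x. x \<bullet> h) \<in> borel_measurable \<mu>"
    by (intro continuous_measurable continuous_intros)
  have pull: "has_bochner_integral \<mu> (\<lambda>x. f (x \<bullet> h)) v"
    if "has_bochner_integral (normal_law a s) f v" "f \<in> borel_measurable borel" for f :: "real \<Rightarrow> real" and v
    using that unfolding has_bochner_integral_iff d[symmetric]
    by (simp add: integrable_distr_eq[OF meas] integral_distr[OF meas])
  note M = normal_law_central_moments[OF s, of a]
  have 1: "has_bochner_integral \<mu> (\<lambda>x. x \<bullet> h - a) 0" using pull[OF M(1)] by simp
  have "has_bochner_integral \<mu> (\<lambda>x. (x \<bullet> h - a) + a) (0 + a)"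
    by (rule has_bochner_integral_add[OF 1 has_bochner_integral_const])
  hence "(\<integral>x. x \<bullet> h \<partial>\<mu>) = a" by (simp add: has_bochner_integral_iff)
  hence a: "a = m \<bullet> h" using gaussian by (simp add: gaussian_measure_def)
  show "has_bochner_integral \<mu> (\<lambda>x. (x - m) \<bullet> h) 0"
    using pull[OF M(1)] by (simp add: a inner_diff_left)
  have 2: "has_bochner_integral \<mu> (\<lambda>x. ((x - m) \<bullet> h) ^ 2) (s\<^sup>2)"
    using pull[OF M(2)] by (simp add: a inner_diff_left)
  have "(\<integral>x. ((x - m) \<bullet> h) * ((x - m) \<bullet> h) \<partial>\<mu>) = C h \<bullet> h"
    using gaussian by (simp add: gaussian_measure_def)
  hence s2: "s\<^sup>2 = C h \<bullet> h"
    using 2 by (simp add: has_bochner_integral_iff power2_eq_square)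
  show "has_bochner_integral \<mu> (\<lambda>x. ((x - m) \<bullet> h) ^ 2) (C h \<bullet> h)" using 2 s2 by simp
  show "has_bochner_integral \<mu> (\<lambda>x. ((x - m) \<bullet> h) ^ 3) 0"
    using pull[OF M(3)] by (simp add: a inner_diff_left)
  show "has_bochner_integral \<mu> (\<lambda>x. ((x - m) \<bullet> h) ^ 4) (3 * (C h \<bullet> h)\<^sup>2)"
    using pull[OF M(4)] s2 by (simp add: a inner_diff_left)
qed

lemma cov_symmetric: "C h \<bullet> k = h \<bullet> C k"
proof -
  have c: "(\<integral>x. ((x - m) \<bullet> h) * ((x - m) \<bullet> k) \<partial>\<mu>) = C h \<bullet> k" for h k
    using gaussian by (simp add: gaussian_measure_def)
  show ?thesis using c[of h k] c[of k h] by (simp add: mult.commute inner_commute)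
qed

lemma cov_commute: "C h \<bullet> k = C k \<bullet> h"
  using cov_symmetric[of h k] by (simp add: inner_commute)

lemma selfadjoint_cov: "selfadjoint_op C"
  unfolding selfadjoint_op_def using bounded_linear_cov cov_symmetric by blast

text \<open>
  Mixed moments follow from moments of single linear functionals by polarisation. This also gives
  integrability of the products.
\<close>

lemma centred_product2:
  "has_bochner_integral \<mu> (\<lambda>x. ((x - m) \<bullet> a) * ((x - m) \<bullet> b)) (C a \<bullet> b)"
proof -
  have "has_bochner_integral \<mu> (\<lambda>x. (((x - m) \<bullet> (a + b))\<^sup>2 - ((x - m) \<bullet> (a - b))\<^sup>2) * (1/4))
      ((C (a + b) \<bullet> (a + b) - C (a - b) \<bullet> (a - b)) * (1/4))"
    by (intro has_bochner_integral_mult_left has_bochner_integral_diff moment2)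
  moreover have "(((x - m) \<bullet> (a + b))\<^sup>2 - ((x - m) \<bullet> (a - b))\<^sup>2) * (1/4) = ((x - m) \<bullet> a) * ((x - m) \<bullet> b)" for x
  proof -
    have "((s + t)\<^sup>2 - (s - t)\<^sup>2) * (1/4) = s * t" for s t :: real by algebra
    thus ?thesis unfolding inner_add_right inner_diff_right .
  qed
  moreover have "(C (a + b) \<bullet> (a + b) - C (a - b) \<bullet> (a - b)) * (1/4) = C a \<bullet> b"
    using cov_symmetric[of b a]
    by (simp add: cov.add cov.diff inner_add inner_diff inner_commute)
  ultimately show ?thesis by simp
qed

lemma centred_product3:
  "has_bochner_integral \<mu> (\<lambda>x. ((x - m) \<bullet> a) * ((x - m) \<bullet> b) * ((x - m) \<bullet> c)) 0"
proof -
  have "has_bochner_integral \<mu> (\<lambda>x. (((x - m) \<bullet> (a + b + c)) ^ 3 - ((x - m) \<bullet> (a + b - c)) ^ 3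
       - ((x - m) \<bullet> (a - b + c)) ^ 3 + ((x - m) \<bullet> (a - b - c)) ^ 3) * (1/24)) ((0 - 0 - 0 + 0) * (1/24))"
    by (intro has_bochner_integral_mult_left has_bochner_integral_diff has_bochner_integral_add moment3)
  moreover have "(((x - m) \<bullet> (a + b + c)) ^ 3 - ((x - m) \<bullet> (a + b - c)) ^ 3
       - ((x - m) \<bullet> (a - b + c)) ^ 3 + ((x - m) \<bullet> (a - b - c)) ^ 3) * (1/24)
       = ((x - m) \<bullet> a) * ((x - m) \<bullet> b) * ((x - m) \<bullet> c)" for x
  proof -
    have "((s + t + u) ^ 3 - (s + t - u) ^ 3 - (s - t + u) ^ 3 + (s - t - u) ^ 3) * (1/24) = s * t * u"
      for s t u :: real by algebra
    thus ?thesis unfolding inner_add_right inner_diff_right .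
  qed
  ultimately show ?thesis by simp
qed

text \<open>
  Three successive polarisations turn the fourth moment of a single functional into Isserlis'
  formula. Polarising one pair at a time keeps the polynomial identities small.
\<close>

lemma fourth_moment_two_squares:
  "has_bochner_integral \<mu> (\<lambda>x. ((x - m) \<bullet> a)\<^sup>2 * ((x - m) \<bullet> b)\<^sup>2)
     ((C a \<bullet> a) * (C b \<bullet> b) + 2 * (C a \<bullet> b)\<^sup>2)"
proof -
  let ?w = "\<lambda>h x. (x - m) \<bullet> h"
  let ?v = "\<lambda>h. 3 * (C h \<bullet> h)\<^sup>2"
  have "has_bochner_integral \<mu>
      (\<lambda>x. (?w (a + b) x ^ 4 + ?w (a - b) x ^ 4 - 2 * ?w a x ^ 4 - 2 * ?w b x ^ 4) * (1/12))
      ((?v (a + b) + ?v (a - b) - 2 * ?v a - 2 * ?v b) * (1/12))"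
    by (intro has_bochner_integral_mult_left has_bochner_integral_mult_right
        has_bochner_integral_diff has_bochner_integral_add moment4)
  moreover have "((s + t) ^ 4 + (s - t) ^ 4 - 2 * s ^ 4 - 2 * t ^ 4) * (1/12) = s\<^sup>2 * t\<^sup>2"
    for s t :: real by algebra
  moreover have "(3 * (p + r + (r + q))\<^sup>2 + 3 * (p - r - (r - q))\<^sup>2 - 2 * (3 * p\<^sup>2) - 2 * (3 * q\<^sup>2)) * (1/12)
      = p * q + 2 * r\<^sup>2" for p q r :: real by algebra
  moreover have "C b \<bullet> a = C a \<bullet> b" by (rule cov_commute)
  ultimately show ?thesis
    by (simp only: cov.add cov.diff inner_add_left inner_diff_left inner_add_right inner_diff_right)
qed

lemma fourth_moment_one_square:
  "has_bochner_integral \<mu> (\<lambda>x. ((x - m) \<bullet> a)\<^sup>2 * (((x - m) \<bullet> b) * ((x - m) \<bullet> c)))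
     ((C a \<bullet> a) * (C b \<bullet> c) + 2 * (C a \<bullet> b) * (C a \<bullet> c))"
proof -
  let ?w = "\<lambda>h x. (x - m) \<bullet> h"
  let ?v = "\<lambda>h. (C a \<bullet> a) * (C h \<bullet> h) + 2 * (C a \<bullet> h)\<^sup>2"
  have "has_bochner_integral \<mu>
      (\<lambda>x. ((?w a x)\<^sup>2 * (?w (b + c) x)\<^sup>2 - (?w a x)\<^sup>2 * (?w (b - c) x)\<^sup>2) * (1/4))
      ((?v (b + c) - ?v (b - c)) * (1/4))"
    by (intro has_bochner_integral_mult_left has_bochner_integral_diff fourth_moment_two_squares)
  moreover have "(s\<^sup>2 * (t + u)\<^sup>2 - s\<^sup>2 * (t - u)\<^sup>2) * (1/4) = s\<^sup>2 * (t * u)"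
    for s t u :: real by algebra
  moreover have "(p * (q + r + (r + s)) + 2 * (t + u)\<^sup>2 - (p * (q - r - (r - s)) + 2 * (t - u)\<^sup>2)) * (1/4)
      = p * r + 2 * t * u" for p q r s t u :: real by algebra
  moreover have "C c \<bullet> b = C b \<bullet> c" by (rule cov_commute)
  ultimately show ?thesis
    by (simp only: cov.add cov.diff inner_add_left inner_diff_left inner_add_right inner_diff_right)
qed

lemma isserlis:
  "has_bochner_integral \<mu>
     (\<lambda>x. ((x - m) \<bullet> a) * ((x - m) \<bullet> b) * (((x - m) \<bullet> c) * ((x - m) \<bullet> d)))
     ((C a \<bullet> b) * (C c \<bullet> d) + (C a \<bullet> c) * (C b \<bullet> d) + (C a \<bullet> d) * (C b \<bullet> c))"
proof -
  let ?w = "\<lambda>h x. (x - m) \<bullet> h"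
  let ?v = "\<lambda>h. (C h \<bullet> h) * (C c \<bullet> d) + 2 * (C h \<bullet> c) * (C h \<bullet> d)"
  have "has_bochner_integral \<mu>
      (\<lambda>x. ((?w (a + b) x)\<^sup>2 * (?w c x * ?w d x) - (?w (a - b) x)\<^sup>2 * (?w c x * ?w d x)) * (1/4))
      ((?v (a + b) - ?v (a - b)) * (1/4))"
    by (intro has_bochner_integral_mult_left has_bochner_integral_diff fourth_moment_one_square)
  moreover have "((s + t)\<^sup>2 * u - (s - t)\<^sup>2 * u) * (1/4) = s * t * u"
    for s t u :: real by algebra
  moreover have "((p + r + (r + q)) * k + 2 * (s + t) * (u + v)
        - ((p - r - (r - q)) * k + 2 * (s - t) * (u - v))) * (1/4)
      = r * k + s * v + u * t" for p q r s t u v k :: real by algebra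
  moreover have "C b \<bullet> a = C a \<bullet> b" by (rule cov_commute)
  ultimately show ?thesis
    by (simp only: cov.add cov.diff inner_add_left inner_diff_left inner_add_right inner_diff_right)
qed

lemma has_bochner_integral_limit:
  fixes f w :: "'a \<Rightarrow> real"
  assumes "\<And>N. has_bochner_integral \<mu> (s N) (v N)" and "f \<in> borel_measurable \<mu>"
    and "integrable \<mu> w" and "\<And>x. (\<lambda>N. s N x) \<longlonglongrightarrow> f x" and "\<And>N x. \<bar>s N x\<bar> \<le> w x"
    and "v \<longlonglongrightarrow> u"
  shows "has_bochner_integral \<mu> f u"
proof -
  have s: "\<And>N. s N \<in> borel_measurable \<mu>" and v: "\<And>N. integral\<^sup>L \<mu> (s N) = v N"
    using assms(1) by (auto simp: has_bochner_integral_iff)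
  have "integrable \<mu> f"
    by (rule integrable_dominated_convergence[where s = s and w = w]) (use assms s in auto)
  moreover have "(\<lambda>N. integral\<^sup>L \<mu> (s N)) \<longlonglongrightarrow> integral\<^sup>L \<mu> f"
    by (rule integral_dominated_convergence[where w = w]) (use assms s in auto)
  hence "integral\<^sup>L \<mu> f = u" using assms(6) LIMSEQ_unique unfolding v by blast
  ultimately show ?thesis by (simp add: has_bochner_integral_iff)
qed

text \<open>
  Along a Parseval sequence these finite sums tend to the quadratic form \<open>H (x - m) \<bullet> (x - m)\<close>.
  They only involve finitely many linear functionals, so their moments are given by Isserlis'
  formula.
\<close>

definition quad_sum :: "(nat \<Rightarrow> 'a) \<Rightarrow> ('a \<Rightarrow> 'a) \<Rightarrow> nat \<Rightarrow> 'a \<Rightarrow> real" where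
  "quad_sum e H N x = (\<Sum>n<N. ((x - m) \<bullet> H (e n)) * ((x - m) \<bullet> e n))"

context
  fixes e :: "nat \<Rightarrow> 'a" and H :: "'a \<Rightarrow> 'a"
  assumes e: "parseval_sequence e" and H: "selfadjoint_op H"
begin

lemma form_linear: "bounded_linear H" and form_sym: "H x \<bullet> y = x \<bullet> H y"
  using H by (auto simp: selfadjoint_op_def)

lemma quad_sum_tendsto: "(\<lambda>N. quad_sum e H N x) \<longlonglongrightarrow> H (x - m) \<bullet> (x - m)"
  using e unfolding parseval_sequence_def quad_sum_def sums_def form_sym[symmetric] by blast

lemma quad_sum_bound: "\<bar>quad_sum e H N x\<bar> \<le> norm (H (x - m)) * norm (x - m)"
  unfolding quad_sum_def form_sym[symmetric]
  using order.trans[OF sum_abs bessel_parseval_sequence[OF e]] .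

lemma quad_sum_moment1:
  "has_bochner_integral \<mu> (quad_sum e H N) (\<Sum>n<N. C (H (e n)) \<bullet> e n)"
  unfolding quad_sum_def by (intro has_bochner_integral_sum centred_product2)

lemma quad_sum_moment1_tendsto:
  "(\<lambda>N. \<Sum>n<N. C (H (e n)) \<bullet> e n) \<longlonglongrightarrow> op_trace (\<lambda>x. C (H x))"
  using parseval_sequence_trace[OF e trace_class_comp_right[OF trace_class form_linear]]
  by (simp add: sums_def)

lemma quad_sum_moment2:
  "has_bochner_integral \<mu> (\<lambda>x. (quad_sum e H N x)\<^sup>2)
     ((\<Sum>n<N. C (H (e n)) \<bullet> e n)\<^sup>2
      + (\<Sum>n<N. \<Sum>k<N. (H (C (H (e n))) \<bullet> e k) * (C (e n) \<bullet> e k))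
      + (\<Sum>n<N. \<Sum>k<N. (C (H (e n)) \<bullet> e k) * (H (C (e n)) \<bullet> e k)))"
proof -
  have "has_bochner_integral \<mu>
     (\<lambda>x. \<Sum>n<N. \<Sum>k<N. ((x - m) \<bullet> H (e n)) * ((x - m) \<bullet> e n) * (((x - m) \<bullet> H (e k)) * ((x - m) \<bullet> e k)))
     (\<Sum>n<N. \<Sum>k<N. (C (H (e n)) \<bullet> e n) * (C (H (e k)) \<bullet> e k)
        + (C (H (e n)) \<bullet> H (e k)) * (C (e n) \<bullet> e k) + (C (H (e n)) \<bullet> e k) * (C (e n) \<bullet> H (e k)))"
    by (intro has_bochner_integral_sum isserlis)
  thus ?thesis
    unfolding quad_sum_def power2_eq_square sum_product sum.distrib
    by (simp add: form_sym)
qed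

lemma trace_class_CH: "trace_class_op (\<lambda>x. C (H x))"
  by (rule trace_class_comp_right[OF trace_class form_linear])

lemma trace_class_HC: "trace_class_op (\<lambda>x. H (C x))"
  by (rule trace_class_comp_left[OF trace_class form_linear])

text \<open>
  Of the three terms in Isserlis' formula the first factors into the square of the mean. The other
  two are Hilbert-Schmidt inner products, of \<open>H \<circ> C \<circ> H\<close> with \<open>C\<close> and of \<open>C \<circ> H\<close> with \<open>H \<circ> C\<close>, and both
  equal the trace of \<open>(C \<circ> H)\<^sup>2\<close>.
\<close>

lemma quad_sum_moment2_tendsto:
  "(\<lambda>N. (\<Sum>n<N. C (H (e n)) \<bullet> e n)\<^sup>2
      + (\<Sum>n<N. \<Sum>k<N. (H (C (H (e n))) \<bullet> e k) * (C (e n) \<bullet> e k))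
      + (\<Sum>n<N. \<Sum>k<N. (C (H (e n)) \<bullet> e k) * (H (C (e n)) \<bullet> e k)))
   \<longlonglongrightarrow> (op_trace (\<lambda>x. C (H x)))\<^sup>2 + 2 * op_trace (\<lambda>x. C (H (C (H x))))"
proof -
  have 1: "adjoint C = C" by (rule adjoint_unique) (simp add: cov_symmetric)
  have 2: "adjoint (\<lambda>x. H (C x)) = (\<lambda>x. C (H x))"
    by (rule adjoint_unique) (simp add: cov_symmetric form_sym)
  have "trace_class_op (\<lambda>x. H (C (H x)))"
    by (rule trace_class_comp_left[OF trace_class_CH form_linear])
  from hilbert_schmidt_double_sum[OF e this trace_class]
    hilbert_schmidt_double_sum[OF e trace_class_CH trace_class_HC]
  show ?thesis unfolding 1 2 mult_2 add.assoc[symmetric]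
    by (intro tendsto_add tendsto_power quad_sum_moment1_tendsto)
qed

end

text \<open>
  For \<open>H = id\<close> the partial sums increase to \<open>\<bar>x - m\<bar>\<^sup>2\<close> and their second moments converge, so
  monotone convergence applies. Up to constants, \<open>1 + \<bar>x - m\<bar>\<^sup>4\<close> then dominates every
  quadratic form of \<open>x - m\<close> and its square.
\<close>

lemma integrable_norm_power4: "integrable \<mu> (\<lambda>x. (norm (x - m)) ^ 4)"
proof -
  obtain e :: "nat \<Rightarrow> 'a" where e: "parseval_sequence e" by (rule parseval_sequence_exists)
  have I: "selfadjoint_op (\<lambda>x::'a. x)" by (simp add: selfadjoint_op_def)
  have nonneg: "0 \<le> quad_sum e (\<lambda>x. x) N x" for N x
    unfolding quad_sum_def by (intro sum_nonneg) simp
  have mono: "quad_sum e (\<lambda>x. x) N x \<le> quad_sum e (\<lambda>x. x) (Suc N) x" for N x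
    unfolding quad_sum_def by simp
  show ?thesis
  proof (rule integrable_monotone_convergence)
    show "integrable \<mu> (\<lambda>x. (quad_sum e (\<lambda>x. x) N x)\<^sup>2)" for N
      using quad_sum_moment2[OF e I] by (simp add: has_bochner_integral_iff)
    show "AE x in \<mu>. mono (\<lambda>N. (quad_sum e (\<lambda>x. x) N x)\<^sup>2)"
      by (intro AE_I2 incseq_SucI power_mono mono nonneg)
    have "(norm (x - m)) ^ 4 = ((x - m) \<bullet> (x - m))\<^sup>2" for x
      by (simp add: dot_square_norm)
    thus "AE x in \<mu>. (\<lambda>N. (quad_sum e (\<lambda>x. x) N x)\<^sup>2) \<longlonglongrightarrow> (norm (x - m)) ^ 4"
      using quad_sum_tendsto[OF e I] by (auto intro!: tendsto_power)
    show "(\<lambda>N. \<integral>x. (quad_sum e (\<lambda>x. x) N x)\<^sup>2 \<partial>\<mu>)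
        \<longlonglongrightarrow> (op_trace (\<lambda>x. C x))\<^sup>2 + 2 * op_trace (\<lambda>x. C (C x))"
      using quad_sum_moment2_tendsto[OF e I]
      unfolding has_bochner_integral_integral_eq[OF quad_sum_moment2[OF e I]] .
    show "(\<lambda>x. (norm (x - m)) ^ 4) \<in> borel_measurable \<mu>"
      by (intro continuous_measurable continuous_intros)
  qed
qed

lemma quadratic_form_moments:
  assumes H: "selfadjoint_op H"
  shows quadratic_form_mean:
      "has_bochner_integral \<mu> (\<lambda>x. H (x - m) \<bullet> (x - m)) (op_trace (\<lambda>x. C (H x)))"
    and quadratic_form_square:
      "has_bochner_integral \<mu> (\<lambda>x. (H (x - m) \<bullet> (x - m))\<^sup>2)
         ((op_trace (\<lambda>x. C (H x)))\<^sup>2 + 2 * op_trace (\<lambda>x. C (H (C (H x)))))"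
    and quadratic_form_linear:
      "has_bochner_integral \<mu> (\<lambda>x. (H (x - m) \<bullet> (x - m)) * ((x - m) \<bullet> l)) 0"
proof -
  obtain e :: "nat \<Rightarrow> 'a" where e: "parseval_sequence e" by (rule parseval_sequence_exists)
  interpret H: bounded_linear H using H by (simp add: selfadjoint_op_def)
  note cont = H.continuous_on continuous_intros
  obtain K where K: "\<And>x. norm (H x) \<le> norm x * K" "K \<ge> 0" using H.nonneg_bounded by auto
  have bound: "\<bar>quad_sum e H N x\<bar> \<le> K * (norm (x - m))\<^sup>2" for N x
  proof -
    have "\<bar>quad_sum e H N x\<bar> \<le> norm (H (x - m)) * norm (x - m)"
      by (rule quad_sum_bound[OF e H])
    also have "\<dots> \<le> (norm (x - m) * K) * norm (x - m)" by (intro mult_right_mono K) simp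
    finally show ?thesis by (simp add: power2_eq_square mult_ac)
  qed
  have pow2: "r\<^sup>2 \<le> 1 + r ^ 4" for r :: real
  proof -
    have "0 \<le> (r\<^sup>2 - 1)\<^sup>2 + r\<^sup>2 * r\<^sup>2 + 1" by simp
    also have "\<dots> = 2 * (1 + r ^ 4 - r\<^sup>2)" by algebra
    finally show ?thesis by simp
  qed
  have pow3: "r\<^sup>2 * r \<le> 1 + r ^ 4" for r :: real
  proof -
    have "0 \<le> (r\<^sup>2 - r)\<^sup>2 + (r\<^sup>2 - 1)\<^sup>2 + r\<^sup>2 + 1" by simp
    also have "\<dots> = 2 * (1 + r ^ 4 - r\<^sup>2 * r)" by algebra
    finally show ?thesis by simp
  qed
  show "has_bochner_integral \<mu> (\<lambda>x. H (x - m) \<bullet> (x - m)) (op_trace (\<lambda>x. C (H x)))"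
  proof (rule has_bochner_integral_limit[OF quad_sum_moment1[OF e H] _ _ quad_sum_tendsto[OF e H] _
        quad_sum_moment1_tendsto[OF e H]])
    show "(\<lambda>x. H (x - m) \<bullet> (x - m)) \<in> borel_measurable \<mu>"
      by (intro continuous_measurable cont)
    show "integrable \<mu> (\<lambda>x. K * (1 + (norm (x - m)) ^ 4))"
      by (intro integrable_mult_right Bochner_Integration.integrable_add integrable_norm_power4) simp
    show "\<bar>quad_sum e H N x\<bar> \<le> K * (1 + (norm (x - m)) ^ 4)" for N x
      using bound[of N x] mult_left_mono[OF pow2[of "norm (x - m)"] K(2)] by linarith
  qed
  show "has_bochner_integral \<mu> (\<lambda>x. (H (x - m) \<bullet> (x - m))\<^sup>2)
         ((op_trace (\<lambda>x. C (H x)))\<^sup>2 + 2 * op_trace (\<lambda>x. C (H (C (H x)))))"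
  proof (rule has_bochner_integral_limit[OF quad_sum_moment2[OF e H] _ _ _ _
        quad_sum_moment2_tendsto[OF e H]])
    show "(\<lambda>x. (H (x - m) \<bullet> (x - m))\<^sup>2) \<in> borel_measurable \<mu>"
      by (intro continuous_measurable cont)
    show "integrable \<mu> (\<lambda>x. K\<^sup>2 * (norm (x - m)) ^ 4)"
      by (intro integrable_mult_right integrable_norm_power4)
    show "(\<lambda>N. (quad_sum e H N x)\<^sup>2) \<longlonglongrightarrow> (H (x - m) \<bullet> (x - m))\<^sup>2" for x
      by (intro tendsto_power quad_sum_tendsto[OF e H])
    show "\<bar>(quad_sum e H N x)\<^sup>2\<bar> \<le> K\<^sup>2 * (norm (x - m)) ^ 4" for N x
      using power_mono[OF bound abs_ge_zero, of N x 2] by (simp add: power_mult_distrib)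
  qed
  have "has_bochner_integral \<mu> (\<lambda>x. quad_sum e H N x * ((x - m) \<bullet> l)) (\<Sum>n<N. 0)" for N
    unfolding quad_sum_def sum_distrib_right by (intro has_bochner_integral_sum centred_product3)
  thus "has_bochner_integral \<mu> (\<lambda>x. (H (x - m) \<bullet> (x - m)) * ((x - m) \<bullet> l)) 0"
  proof (rule has_bochner_integral_limit)
    show "(\<lambda>x. (H (x - m) \<bullet> (x - m)) * ((x - m) \<bullet> l)) \<in> borel_measurable \<mu>"
      by (intro continuous_measurable cont)
    show "integrable \<mu> (\<lambda>x. K * norm l * (1 + (norm (x - m)) ^ 4))"
      by (intro integrable_mult_right Bochner_Integration.integrable_add integrable_norm_power4) simp
    show "(\<lambda>N. quad_sum e H N x * ((x - m) \<bullet> l)) \<longlonglongrightarrow> (H (x - m) \<bullet> (x - m)) * ((x - m) \<bullet> l)" for x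
      by (intro tendsto_mult_right quad_sum_tendsto[OF e H])
    show "\<bar>quad_sum e H N x * ((x - m) \<bullet> l)\<bar> \<le> K * norm l * (1 + (norm (x - m)) ^ 4)" for N x
    proof -
      have "\<bar>quad_sum e H N x * ((x - m) \<bullet> l)\<bar> \<le> (K * (norm (x - m))\<^sup>2) * (norm (x - m) * norm l)"
        unfolding abs_mult by (intro mult_mono bound Cauchy_Schwarz_ineq2) (auto simp: K)
      also have "\<dots> = (K * norm l) * ((norm (x - m))\<^sup>2 * norm (x - m))" by simp
      also have "\<dots> \<le> (K * norm l) * (1 + (norm (x - m)) ^ 4)"
        by (intro mult_left_mono pow3) (simp add: K)
      finally show ?thesis .
    qed
    show "(\<lambda>N. \<Sum>n<N. 0) \<longlonglongrightarrow> (0::real)" by simp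
  qed
qed

text \<open>
  The linear and the quadratic part of \<open>q\<close> are uncorrelated because third moments vanish, so their
  variances add up. The variance of the quadratic part is the second moment in
  \<open>quadratic_form_square\<close> minus the square of the mean.
\<close>

lemma quadratic_variance:
  assumes H: "selfadjoint_op H"
    and q: "q = (\<lambda>x. c + l \<bullet> (x - m) + 1/2 * (H (x - m) \<bullet> (x - m)))"
  shows quadratic_square_integrable: "integrable \<mu> (\<lambda>x. (q x)\<^sup>2)"
    and quadratic_variance_eq: "variance q = C l \<bullet> l + 1/2 * op_trace (\<lambda>x. C (H (C (H x))))"
proof -
  define t where "t = op_trace (\<lambda>x. C (H x))"
  define t2 where "t2 = op_trace (\<lambda>x. C (H (C (H x))))"
  note M = quadratic_form_moments[OF H, folded t_def t2_def]
  have mean: "has_bochner_integral \<mu> q (c + 0 + 1/2 * t)"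
    unfolding q inner_commute[of l] by (intro has_bochner_integral_add has_bochner_integral_const
        has_bochner_integral_mult_right M moment1)
  hence Eq: "expectation q = c + t / 2" by (simp add: has_bochner_integral_iff)
  have sq: "has_bochner_integral \<mu> (\<lambda>x. (q x - (c + t / 2))\<^sup>2)
      (C l \<bullet> l + 0 + 1/4 * (t\<^sup>2 + 2 * t2) - 1/2 * t * t - t * 0 + (t / 2)\<^sup>2)"
  proof -
    have "has_bochner_integral \<mu>
      (\<lambda>x. ((x - m) \<bullet> l)\<^sup>2 + (H (x - m) \<bullet> (x - m)) * ((x - m) \<bullet> l) + 1/4 * (H (x - m) \<bullet> (x - m))\<^sup>2
        - 1/2 * t * (H (x - m) \<bullet> (x - m)) - t * ((x - m) \<bullet> l) + (t / 2)\<^sup>2)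
      (C l \<bullet> l + 0 + 1/4 * (t\<^sup>2 + 2 * t2) - 1/2 * t * t - t * 0 + (t / 2)\<^sup>2)"
      by (intro has_bochner_integral_add has_bochner_integral_diff has_bochner_integral_mult_right
          has_bochner_integral_const moment1 moment2 M)
    moreover have "a\<^sup>2 + b * a + 1/4 * b\<^sup>2 - 1/2 * t * b - t * a + (t / 2)\<^sup>2
        = (c + a + 1/2 * b - (c + t / 2))\<^sup>2" for a b :: real
      by (simp add: power2_eq_square field_simps)
    ultimately show ?thesis unfolding q by (simp only: inner_commute[of l])
  qed
  show "variance q = C l \<bullet> l + 1/2 * op_trace (\<lambda>x. C (H (C (H x))))"
    using sq unfolding Eq t2_def[symmetric]
    by (simp add: has_bochner_integral_iff power2_eq_square field_simps)
  have "integrable \<mu> (\<lambda>x. (q x - (c + t / 2))\<^sup>2 + 2 * (c + t / 2) * q x - (c + t / 2)\<^sup>2)"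
    using sq mean by (auto simp: has_bochner_integral_iff)
  moreover have "(q x - (c + t / 2))\<^sup>2 + 2 * (c + t / 2) * q x - (c + t / 2)\<^sup>2 = (q x)\<^sup>2" for x
    by (simp add: power2_eq_square algebra_simps)
  ultimately show "integrable \<mu> (\<lambda>x. (q x)\<^sup>2)" by simp
qed

text \<open>
  The cross term is linear in \<open>x - m\<close> and integrates to zero. The quadratic term is the form of
  \<open>adjoint U \<circ> D \<circ> U\<close>, whose mean is a trace.
\<close>

lemma affine_quadratic_mean:
  fixes U :: "'a \<Rightarrow> 'b::real_inner"
  assumes D: "selfadjoint_op D" and U: "bounded_linear U"
  shows "has_bochner_integral \<mu> (\<lambda>x. D (l + U (x - m)) \<bullet> (l + U (x - m)))
    (D l \<bullet> l + op_trace (\<lambda>x. C (adjoint U (D (U x)))))"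
proof -
  have Dsym: "D x \<bullet> y = x \<bullet> D y" for x y using D by (simp add: selfadjoint_op_def)
  interpret D: bounded_linear D using D by (simp add: selfadjoint_op_def)
  interpret U: bounded_linear U by fact
  have "bounded_linear (\<lambda>x. adjoint U (D (U x)))"
    by (rule bounded_linear_compose[OF bounded_linear_adjoint[OF U]
          bounded_linear_compose[OF D.bounded_linear_axioms U]])
  hence H: "selfadjoint_op (\<lambda>x. adjoint U (D (U x)))"
    unfolding selfadjoint_op_def
    by (simp add: adjoint_inner'[OF U] adjoint_inner[OF U, symmetric] Dsym)
  have "has_bochner_integral \<mu> (\<lambda>x. D l \<bullet> l + 2 * ((x - m) \<bullet> adjoint U (D l))
       + adjoint U (D (U (x - m))) \<bullet> (x - m))
     (D l \<bullet> l + 2 * 0 + op_trace (\<lambda>x. C (adjoint U (D (U x)))))"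
    by (intro has_bochner_integral_add has_bochner_integral_mult_right has_bochner_integral_const
        moment1 quadratic_form_mean[OF H])
  moreover have "D l \<bullet> l + 2 * ((x - m) \<bullet> adjoint U (D l)) + adjoint U (D (U (x - m))) \<bullet> (x - m)
      = D (l + U (x - m)) \<bullet> (l + U (x - m))" for x
    using Dsym[of "U (x - m)" l]
    by (simp add: adjoint_inner'[OF U] adjoint_inner[OF U, symmetric] D.add inner_add inner_commute)
  ultimately show ?thesis by simp
qed

end

section \<open>Gradient and Hessian\<close>

lemma GDERIV_gradient:
  fixes Z :: "'a::{real_inner, banach} \<Rightarrow> real"
  assumes "Z differentiable (at x)"
  shows "GDERIV Z x :> gradient Z x"
proof -
  obtain f' where f': "(Z has_derivative f') (at x)" using assms by (auto simp: differentiable_def)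
  obtain r where r: "\<And>h. f' h = r \<bullet> h"
    by (rule riesz_representation[OF has_derivative_bounded_linear[OF f']]) (rule that)
  have eq: "f' = (\<lambda>h. h \<bullet> r)"
    by (rule ext) (metis r inner_commute)
  have G: "GDERIV Z x :> r" using f' unfolding gderiv_def eq .
  show ?thesis unfolding gradient_def
  proof (rule theI)
    fix g assume "GDERIV Z x :> g"
    hence "(\<lambda>h. h \<bullet> g) = (\<lambda>h. h \<bullet> r)"
      using G unfolding gderiv_def by (rule has_derivative_unique)
    hence "(g - r) \<bullet> g = (g - r) \<bullet> r" by (rule fun_cong)
    hence "(g - r) \<bullet> g - (g - r) \<bullet> r = 0" by linarith
    hence "(g - r) \<bullet> (g - r) = 0" unfolding inner_diff_right .
    thus "g = r" unfolding inner_eq_zero_iff right_minus_eq .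
  qed (rule G)
qed

text \<open>
  The mean value theorem in the direction \<open>u\<close> turns the second difference into \<open>t\<close> times an increment
  of \<open>G\<close> over the step \<open>t *\<^sub>R v\<close>, which the derivative \<open>H\<close> of \<open>G\<close> approximates.
\<close>

lemma second_difference_estimate:
  fixes Z :: "'a::real_inner \<Rightarrow> real"
  assumes grad: "\<And>x. GDERIV Z x :> G x"
    and H: "bounded_linear H"
    and approx: "\<And>k. norm k < d \<Longrightarrow> norm (G (x + k) - G x - H k) \<le> \<epsilon> * norm k"
    and t: "t > 0" "t * (norm u + norm v) < d" and \<epsilon>: "\<epsilon> > 0"
  shows "\<bar>(Z (x + t *\<^sub>R u + t *\<^sub>R v) - Z (x + t *\<^sub>R u) - Z (x + t *\<^sub>R v) + Z x) - t\<^sup>2 * (u \<bullet> H v)\<bar>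
    \<le> t\<^sup>2 * (2 * \<epsilon> * (norm u + norm v)\<^sup>2)"
proof -
  interpret H: bounded_linear H by fact
  (* The increment of this function over [0, t] is the second difference. *)
  define \<phi> where "\<phi> s = Z (x + s *\<^sub>R u + t *\<^sub>R v) - Z (x + s *\<^sub>R u)" for s
  have line: "((\<lambda>s. Z (x + s *\<^sub>R u + w)) has_real_derivative (u \<bullet> G (x + s *\<^sub>R u + w))) (at s)" for s w
  proof -
    have "((\<lambda>s. x + s *\<^sub>R u + w) has_derivative (\<lambda>h. h *\<^sub>R u)) (at s)"
      by (auto intro!: derivative_eq_intros)
    from has_derivative_compose[OF this grad[unfolded gderiv_def]]
    show ?thesis
      unfolding has_field_derivative_def
      by (rule has_derivative_eq_rhs) (simp add: fun_eq_iff mult.commute)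
  qed
  have "DERIV \<phi> s :> u \<bullet> G (x + s *\<^sub>R u + t *\<^sub>R v) - u \<bullet> G (x + s *\<^sub>R u)" for s
    unfolding \<phi>_def using DERIV_diff[OF line[of "t *\<^sub>R v" s] line[of 0 s]] by simp
  from MVT2[OF t(1) this] obtain s where s: "0 < s" "s < t" and
    mv: "\<phi> t - \<phi> 0 = t * (u \<bullet> G (x + s *\<^sub>R u + t *\<^sub>R v) - u \<bullet> G (x + s *\<^sub>R u))" by auto
  define r1 where "r1 = G (x + (s *\<^sub>R u + t *\<^sub>R v)) - G x - H (s *\<^sub>R u + t *\<^sub>R v)"
  define r2 where "r2 = G (x + s *\<^sub>R u) - G x - H (s *\<^sub>R u)"
  have su: "norm (s *\<^sub>R u) \<le> t * norm u" using s by (simp add: mult_right_mono)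
  have n1: "norm (s *\<^sub>R u + t *\<^sub>R v) \<le> t * (norm u + norm v)"
    using norm_triangle_ineq[of "s *\<^sub>R u" "t *\<^sub>R v"] su t(1) by (simp add: distrib_left)
  have n2: "norm (s *\<^sub>R u) \<le> t * (norm u + norm v)"
    using su t(1) by (smt (verit) norm_ge_zero mult_left_mono)
  have r1: "norm r1 \<le> \<epsilon> * (t * (norm u + norm v))"
    unfolding r1_def using approx[of "s *\<^sub>R u + t *\<^sub>R v"] n1 t(2) mult_left_mono[OF n1, of \<epsilon>] \<epsilon> by linarith
  have r2: "norm r2 \<le> \<epsilon> * (t * (norm u + norm v))"
    unfolding r2_def using approx[of "s *\<^sub>R u"] n2 t(2) mult_left_mono[OF n2, of \<epsilon>] \<epsilon> by linarith
  have "\<phi> t - \<phi> 0 - t\<^sup>2 * (u \<bullet> H v) = t * (u \<bullet> (r1 - r2))"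
    unfolding mv r1_def r2_def
    by (simp add: H.add H.scaleR inner_add inner_diff algebra_simps power2_eq_square)
  moreover have "\<bar>t * (u \<bullet> (r1 - r2))\<bar> \<le> t * (norm u * (2 * (\<epsilon> * (t * (norm u + norm v)))))"
  proof -
    have "\<bar>u \<bullet> (r1 - r2)\<bar> \<le> norm u * norm (r1 - r2)" by (rule Cauchy_Schwarz_ineq2)
    also have "\<dots> \<le> norm u * (2 * (\<epsilon> * (t * (norm u + norm v))))"
      using norm_triangle_ineq4[of r1 r2] r1 r2 by (intro mult_left_mono) auto
    finally show ?thesis using t(1) by (simp add: abs_mult)
  qed
  moreover have "t * (norm u * (2 * (\<epsilon> * (t * (norm u + norm v))))) \<le> t\<^sup>2 * (2 * \<epsilon> * (norm u + norm v)\<^sup>2)"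
  proof -
    have "norm u * (2 * (\<epsilon> * (t * (norm u + norm v)))) \<le> (norm u + norm v) * (2 * (\<epsilon> * (t * (norm u + norm v))))"
      by (rule mult_right_mono) (use \<epsilon> t(1) in auto)
    hence "t * (norm u * (2 * (\<epsilon> * (t * (norm u + norm v)))))
        \<le> t * ((norm u + norm v) * (2 * (\<epsilon> * (t * (norm u + norm v)))))"
      by (rule mult_left_mono) (use t(1) in simp)
    also have "\<dots> = t\<^sup>2 * (2 * \<epsilon> * (norm u + norm v)\<^sup>2)" by algebra
    finally show ?thesis .
  qed
  moreover have "\<phi> t - \<phi> 0 = Z (x + t *\<^sub>R u + t *\<^sub>R v) - Z (x + t *\<^sub>R u) - Z (x + t *\<^sub>R v) + Z x"
    by (simp add: \<phi>_def)
  ultimately show ?thesis by linarith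
qed

text \<open>
  The second difference is symmetric in \<open>u\<close> and \<open>v\<close>, and both \<open>u \<bullet> H v\<close> and \<open>v \<bullet> H u\<close> are its limit
  after division by \<open>t\<^sup>2\<close>.
\<close>

lemma second_derivative_symmetric:
  fixes Z :: "'a::real_inner \<Rightarrow> real"
  assumes grad: "\<And>x. GDERIV Z x :> G x" and H: "(G has_derivative H) (at x)"
  shows "u \<bullet> H v = v \<bullet> H u"
proof -
  note blH = has_derivative_bounded_linear[OF H]
  define B where "B = 4 * (norm u + norm v)\<^sup>2"
  have est: "\<bar>u \<bullet> H v - v \<bullet> H u\<bar> \<le> \<epsilon> * B" if \<epsilon>: "\<epsilon> > 0" for \<epsilon>
  proof -
    obtain d where d: "d > 0" "\<And>y. norm (y - x) < d \<Longrightarrow> norm (G y - G x - H (y - x)) \<le> \<epsilon> * norm (y - x)"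
      using H \<epsilon> unfolding has_derivative_at_alt by blast
    have approx: "norm (G (x + k) - G x - H k) \<le> \<epsilon> * norm k" if "norm k < d" for k
      using d(2)[of "x + k"] that by simp
    define t where "t = d / (2 * (norm u + norm v + 1))"
    have pos: "0 < 2 * (norm u + norm v + 1)" by (simp add: add_nonneg_pos)
    have t: "t > 0" using d(1) pos by (simp add: t_def)
    have td: "t * (2 * (norm u + norm v + 1)) = d" using pos unfolding t_def by simp
    have "t * (norm u + norm v) < t * (2 * (norm u + norm v + 1))"
      by (rule mult_strict_left_mono[OF _ t]) (smt (verit) norm_ge_zero)
    hence tuv: "t * (norm u + norm v) < d" "t * (norm v + norm u) < d"
      unfolding td by (simp_all add: add.commute)
    have swap: "x + t *\<^sub>R v + t *\<^sub>R u = x + t *\<^sub>R u + t *\<^sub>R v" by simp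
    from second_difference_estimate[OF grad blH approx t tuv(1) \<epsilon>]
      second_difference_estimate[OF grad blH approx t tuv(2) \<epsilon>, unfolded swap]
    have "\<bar>t\<^sup>2 * (u \<bullet> H v) - t\<^sup>2 * (v \<bullet> H u)\<bar> \<le> t\<^sup>2 * (2 * \<epsilon> * (norm u + norm v)\<^sup>2) + t\<^sup>2 * (2 * \<epsilon> * (norm u + norm v)\<^sup>2)"
      unfolding add.commute[of "norm v"] by linarith
    also have "\<dots> = t\<^sup>2 * (\<epsilon> * B)" by (simp add: B_def)
    also have "\<bar>t\<^sup>2 * (u \<bullet> H v) - t\<^sup>2 * (v \<bullet> H u)\<bar> = t\<^sup>2 * \<bar>u \<bullet> H v - v \<bullet> H u\<bar>"
      by (simp add: right_diff_distrib[symmetric] abs_mult)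
    finally show ?thesis using t by simp
  qed
  have "\<bar>u \<bullet> H v - v \<bullet> H u\<bar> \<le> 0"
  proof (rule field_le_epsilon)
    fix \<delta> :: real assume \<delta>: "\<delta> > 0"
    have B: "B \<ge> 0" by (simp add: B_def)
    have "\<bar>u \<bullet> H v - v \<bullet> H u\<bar> \<le> \<delta> / (B + 1) * B" by (rule est) (use \<delta> B in simp)
    also have "\<dots> \<le> 0 + \<delta>" using \<delta> B by (simp add: field_simps)
    finally show "\<bar>u \<bullet> H v - v \<bullet> H u\<bar> \<le> 0 + \<delta>" .
  qed
  thus ?thesis by simp
qed

lemma selfadjoint_hessian:
  fixes Z :: "'a::{real_inner, banach} \<Rightarrow> real"
  assumes "twice_differentiable Z"
  shows "selfadjoint_op (hessian Z x)"
proof -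
  have H: "(gradient Z has_derivative hessian Z x) (at x)"
    using assms unfolding twice_differentiable_def hessian_def by (simp add: frechet_derivative_works)
  have G: "GDERIV Z y :> gradient Z y" for y
    using assms GDERIV_gradient unfolding twice_differentiable_def by blast
  have "hessian Z x u \<bullet> v = u \<bullet> hessian Z x v" for u v
    using second_derivative_symmetric[OF G H, of u v] by (simp add: inner_commute)
  thus ?thesis using has_derivative_bounded_linear[OF H] by (simp add: selfadjoint_op_def)
qed

section \<open>The posterior covariance\<close>

text \<open>
  The data space has finite dimension, so the covariance of the data,
  \<open>\<sigma>\<^sup>2 I + F Cpr F\<^sup>*\<close>, is inverted by linear algebra. Through the Woodbury formula this inverse gives the
  posterior covariance as a finite rank perturbation of the prior covariance.
\<close>

locale linear_inverse_problem =
  fixes Cpr :: "'h::{real_inner, banach, second_countable_topology} \<Rightarrow> 'h"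
    and F :: "'h \<Rightarrow> real ^ 'd" and \<sigma> :: real
  assumes Cpr_selfadjoint: "selfadjoint_op Cpr"
    and Cpr_positive: "strictly_positive_op Cpr"
    and Cpr_trace_class: "trace_class_op Cpr"
    and F_bounded: "bounded_linear F"
    and \<sigma>_pos: "\<sigma> > 0"
begin

sublocale Cpr: bounded_linear Cpr using Cpr_trace_class by (rule trace_class_bounded_linear)
sublocale F: bounded_linear F by (rule F_bounded)
sublocale Fa: bounded_linear "adjoint F" by (rule bounded_linear_adjoint[OF F_bounded])

lemma Cpr_sym: "Cpr x \<bullet> y = x \<bullet> Cpr y"
  using Cpr_selfadjoint by (simp add: selfadjoint_op_def)

lemma Cpr_nonneg: "0 \<le> Cpr x \<bullet> x"
  using Cpr_positive unfolding strictly_positive_op_def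
  by (cases "x = 0") (auto simp: Cpr.zero less_imp_le)

lemma inj_Cpr: "inj Cpr"
proof (rule injI, rule ccontr)
  fix x y assume "Cpr x = Cpr y" "x \<noteq> y"
  hence "Cpr (x - y) \<bullet> (x - y) = 0" "x - y \<noteq> 0" by (simp_all add: Cpr.diff)
  thus False using Cpr_positive unfolding strictly_positive_op_def by fastforce
qed

text \<open>
  The part \<open>\<sigma>\<^sup>-\<^sup>2 F\<^sup>* F\<close> of the posterior precision that is due to the data.
\<close>

definition data_precision :: "'h \<Rightarrow> 'h" where
  "data_precision u = (1 / \<sigma>\<^sup>2) *\<^sub>R adjoint F (F u)"

sublocale W: bounded_linear data_precision
  unfolding data_precision_def
  by (intro bounded_linear_compose[OF bounded_linear_scaleR_right]
      bounded_linear_compose[OF Fa.bounded_linear_axioms F_bounded])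

lemma W_sym: "data_precision x \<bullet> y = x \<bullet> data_precision y"
  unfolding data_precision_def by (simp add: adjoint_inner'[OF F_bounded] adjoint_inner[OF F_bounded, symmetric])

lemma W_nonneg: "0 \<le> data_precision x \<bullet> x"
  unfolding data_precision_def by (simp add: adjoint_inner'[OF F_bounded])

text \<open>
  On \<open>range Cpr\<close> the posterior precision is the sum of a nonnegative and a strictly positive form.
\<close>

lemma inj_on_posterior_precision:
  "inj_on (\<lambda>u. (1 / \<sigma>\<^sup>2) *\<^sub>R adjoint F (F u) + inv Cpr u) (range Cpr)"
proof (rule inj_onI)
  fix p q assume "p \<in> range Cpr" "q \<in> range Cpr"
    and eq: "(1 / \<sigma>\<^sup>2) *\<^sub>R adjoint F (F p) + inv Cpr p = (1 / \<sigma>\<^sup>2) *\<^sub>R adjoint F (F q) + inv Cpr q"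
  then obtain u v where uv: "p = Cpr u" "q = Cpr v" by auto
  have "data_precision (Cpr u) + u = data_precision (Cpr v) + v"
    using eq by (simp add: uv inv_f_f[OF inj_Cpr] data_precision_def)
  hence d: "data_precision (Cpr (u - v)) + (u - v) = 0"
    by (simp add: Cpr.diff W.diff algebra_simps)
  have "data_precision (Cpr (u - v)) \<bullet> Cpr (u - v) + Cpr (u - v) \<bullet> (u - v) = 0"
    using arg_cong[OF d, of "\<lambda>w. w \<bullet> Cpr (u - v)"] by (simp add: inner_add_left inner_commute[of "u - v"])
  hence "Cpr (u - v) \<bullet> (u - v) = 0"
    using W_nonneg[of "Cpr (u - v)"] Cpr_nonneg[of "u - v"] by linarith
  hence "u - v = 0" using Cpr_positive unfolding strictly_positive_op_def by fastforce
  thus "p = q" by (simp add: uv)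
qed

lemma data_covariance_inverse:
  obtains M where "linear M" "\<And>y. \<sigma>\<^sup>2 *\<^sub>R M y + F (Cpr (adjoint F (M y))) = y"
proof -
  let ?N = "\<lambda>y. \<sigma>\<^sup>2 *\<^sub>R y + F (Cpr (adjoint F y))"
  have bl: "bounded_linear ?N"
    by (intro bounded_linear_add bounded_linear_scaleR_right bounded_linear_compose[OF F_bounded]
        bounded_linear_compose[OF Cpr.bounded_linear_axioms] Fa.bounded_linear_axioms)
  have pos: "?N y \<bullet> y \<ge> \<sigma>\<^sup>2 * (y \<bullet> y)" for y
    using Cpr_nonneg[of "adjoint F y"] by (simp add: inner_add_left adjoint_inner[OF F_bounded])
  have "inj ?N"
  proof (rule linear_injective_0[OF bounded_linear.linear[OF bl], THEN iffD2], intro allI impI)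
    fix y assume "?N y = 0"
    hence "\<sigma>\<^sup>2 * (y \<bullet> y) \<le> 0" using pos[of y] by simp
    hence "y \<bullet> y \<le> 0" using \<sigma>_pos by (simp add: mult_le_0_iff)
    thus "y = 0" by (metis inner_ge_zero inner_eq_zero_iff order_antisym)
  qed
  then obtain M where "linear M" "\<forall>y. ?N (M y) = y"
    using linear_injective_isomorphism[OF bounded_linear.linear[OF bl]] by blast
  thus thesis using that by blast
qed

text \<open>
  The Woodbury formula and the equation \<open>post_cov (W + Cpr\<^sup>-\<^sup>1) = id\<close> on \<open>range Cpr\<close>, which is stated
  for arguments \<open>Cpr h\<close> so that the unbounded inverse disappears. The formula is verified by applying
  the precision to its right-hand side: the defining property of \<open>M\<close> turns the data term into
  \<open>F\<^sup>* M F Cpr h\<close>, which cancels.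
\<close>

lemma post_cov_woodbury:
  obtains M :: "real ^ 'd \<Rightarrow> real ^ 'd"
  where "linear M" "\<And>h. post_cov Cpr F \<sigma> h = Cpr h - Cpr (adjoint F (M (F (Cpr h))))"
    "\<And>h. post_cov Cpr F \<sigma> (data_precision (Cpr h) + h) = Cpr h"
proof -
  obtain M where M: "linear M" "\<And>y. \<sigma>\<^sup>2 *\<^sub>R M y + F (Cpr (adjoint F (M y))) = y"
    by (rule data_covariance_inverse) (rule that)
  let ?L = "\<lambda>u. (1 / \<sigma>\<^sup>2) *\<^sub>R adjoint F (F u) + inv Cpr u"
  have "post_cov Cpr F \<sigma> h = Cpr (h - adjoint F (M (F (Cpr h))))" for h
    unfolding post_cov_def
  proof (rule inv_into_f_eq[OF inj_on_posterior_precision])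
    let ?k = "M (F (Cpr h))"
    have "F (Cpr h) - F (Cpr (adjoint F ?k)) = \<sigma>\<^sup>2 *\<^sub>R ?k"
      using M(2)[of "F (Cpr h)"] by (simp add: algebra_simps)
    hence "(1 / \<sigma>\<^sup>2) *\<^sub>R adjoint F (F (Cpr (h - adjoint F ?k))) = adjoint F ?k"
      using \<sigma>_pos by (simp add: Cpr.diff F.diff Fa.scaleR)
    thus "?L (Cpr (h - adjoint F ?k)) = h" by (simp add: inv_f_f[OF inj_Cpr])
  qed simp
  hence 1: "post_cov Cpr F \<sigma> h = Cpr h - Cpr (adjoint F (M (F (Cpr h))))" for h
    by (simp add: Cpr.diff)
  have 2: "post_cov Cpr F \<sigma> (data_precision (Cpr h) + h) = Cpr h" for h
    unfolding post_cov_def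
    by (rule inv_into_f_eq[OF inj_on_posterior_precision])
       (simp_all add: data_precision_def inv_f_f[OF inj_Cpr])
  show thesis by (rule that[OF M(1) 1 2])
qed

lemma post_cov_precision: "post_cov Cpr F \<sigma> (data_precision (Cpr h) + h) = Cpr h"
  by (rule post_cov_woodbury) blast

lemma trace_class_post_cov: "trace_class_op (post_cov Cpr F \<sigma>)"
proof -
  obtain M where M: "linear M"
    "\<And>h. post_cov Cpr F \<sigma> h = Cpr h - Cpr (adjoint F (M (F (Cpr h))))"
    by (rule post_cov_woodbury) (rule that)
  let ?R = "\<lambda>h. M (F (Cpr h))"
  have R: "bounded_linear ?R"
    by (intro bounded_linear_compose[OF linear_conv_bounded_linear[THEN iffD1, OF M(1)]]
        bounded_linear_compose[OF F_bounded] Cpr.bounded_linear_axioms)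
  have "post_cov Cpr F \<sigma> h = Cpr h + (\<Sum>i\<in>Basis. (adjoint ?R i \<bullet> h) *\<^sub>R (- Cpr (adjoint F i)))" for h
  proof -
    have "Cpr (adjoint F (?R h)) = Cpr (adjoint F (\<Sum>i\<in>Basis. (?R h \<bullet> i) *\<^sub>R i))"
      by (simp add: euclidean_representation)
    also have "\<dots> = (\<Sum>i\<in>Basis. (adjoint ?R i \<bullet> h) *\<^sub>R Cpr (adjoint F i))"
      by (simp add: Cpr.sum Fa.sum Cpr.scaleR Fa.scaleR adjoint_inner'[OF R] inner_commute[of "M _"])
    finally show ?thesis by (simp add: M(2) sum_negf)
  qed
  hence eq: "post_cov Cpr F \<sigma> = (\<lambda>h. Cpr h + (\<Sum>i\<in>Basis. (adjoint ?R i \<bullet> h) *\<^sub>R (- Cpr (adjoint F i))))"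
    by (rule ext)
  show ?thesis unfolding eq by (rule trace_class_add_finite_rank[OF Cpr_trace_class finite_Basis])
qed

sublocale Cpost: bounded_linear "post_cov Cpr F \<sigma>"
  by (rule trace_class_bounded_linear[OF trace_class_post_cov])

text \<open>
  The Kalman gain \<open>\<sigma>\<^sup>-\<^sup>2 Cpost F\<^sup>*\<close>: the MAP point depends on the data as
  \<open>mpr + gain (y - F mpr)\<close>.
\<close>

definition gain :: "real ^ 'd \<Rightarrow> 'h" where
  "gain y = (1 / \<sigma>\<^sup>2) *\<^sub>R post_cov Cpr F \<sigma> (adjoint F y)"

sublocale gain: bounded_linear gain
  unfolding gain_def
  by (intro bounded_linear_compose[OF bounded_linear_scaleR_right]
      bounded_linear_compose[OF Cpost.bounded_linear_axioms] Fa.bounded_linear_axioms)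

lemma gain_F: "gain (F x) = post_cov Cpr F \<sigma> (data_precision x)"
  by (simp add: gain_def data_precision_def Cpost.scaleR)

lemma gain_F_Cpr: "gain (F (Cpr x)) = Cpr x - post_cov Cpr F \<sigma> x"
  using post_cov_precision[of x] by (simp add: gain_F Cpost.add algebra_simps)

lemma map_point_eq:
  assumes "mpr \<in> range Cpr"
  shows "map_point Cpr mpr F \<sigma> y = mpr + gain (y - F mpr)"
proof -
  obtain u where u: "mpr = Cpr u" using assms by auto
  have "map_point Cpr mpr F \<sigma> y = gain y + post_cov Cpr F \<sigma> u"
    unfolding map_point_def u inv_f_f[OF inj_Cpr] by (simp add: Cpost.add Cpost.scaleR gain_def)
  thus ?thesis using gain_F_Cpr[of u] by (simp add: u gain.diff)
qed

text \<open>
  The MAP point has covariance \<open>gain F Cpr (gain F)\<^sup>* + \<sigma>\<^sup>2 gain gain\<^sup>* = Cpr - Cpost\<close>, the two terms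
  coming from the prior and from the noise. The lemma is the trace of this identity against \<open>T\<close>. Here
  \<open>(gain F)\<^sup>* = data_precision Cpost\<close>, and the sum over the basis is the trace of the finite rank
  operator \<open>\<sigma>\<^sup>2 gain gain\<^sup>* T\<close>.
\<close>

lemma op_trace_map_point_cov:
  assumes post_sym: "\<And>x y. post_cov Cpr F \<sigma> x \<bullet> y = x \<bullet> post_cov Cpr F \<sigma> y"
    and T: "selfadjoint_op T"
  shows "op_trace (\<lambda>x. Cpr (data_precision (post_cov Cpr F \<sigma> (T (gain (F x))))))
       + \<sigma>\<^sup>2 * (\<Sum>i\<in>Basis. T (gain i) \<bullet> gain i)
     = op_trace (\<lambda>x. Cpr (T x)) - op_trace (\<lambda>x. post_cov Cpr F \<sigma> (T x))"
proof -
  let ?C = "post_cov Cpr F \<sigma>"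
  have T_lin: "bounded_linear T" and T_sym: "\<And>x y. T x \<bullet> y = x \<bullet> T y"
    using T by (auto simp: selfadjoint_op_def)
  have eqI: "v = w" if "\<And>x. v \<bullet> x = w \<bullet> x" for v w :: 'h
    using that[of "v - w"] by (metis inner_eq_zero_iff inner_diff_left right_minus_eq)
  have Cpr_W_C: "Cpr (data_precision (?C z)) = Cpr z - ?C z" for z
  proof (rule eqI)
    fix k
    have "Cpr (data_precision (?C z)) \<bullet> k = z \<bullet> gain (F (Cpr k))"
      by (simp add: Cpr_sym W_sym post_sym gain_F)
    thus "Cpr (data_precision (?C z)) \<bullet> k = (Cpr z - ?C z) \<bullet> k"
      by (simp add: gain_F_Cpr inner_diff_left inner_diff_right Cpr_sym post_sym)
  qed
  have C_W_C: "?C (data_precision (?C z)) = (\<Sum>i\<in>Basis. (\<sigma>\<^sup>2 * (z \<bullet> gain i)) *\<^sub>R gain i)" for z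
  proof -
    have "?C (data_precision (?C z)) = gain (\<Sum>i\<in>Basis. (F (?C z) \<bullet> i) *\<^sub>R i)"
      by (simp add: euclidean_representation gain_F)
    also have "\<dots> = (\<Sum>i\<in>Basis. (F (?C z) \<bullet> i) *\<^sub>R gain i)"
      by (simp add: gain.sum gain.scaleR)
    also have "\<dots> = (\<Sum>i\<in>Basis. (\<sigma>\<^sup>2 * (z \<bullet> gain i)) *\<^sub>R gain i)"
      using \<sigma>_pos by (intro sum.cong) (auto simp: adjoint_inner[OF F_bounded] post_sym gain_def)
    finally show ?thesis .
  qed
  have PN: "gain (F (Cpr (data_precision (?C (T x)))))
      = (Cpr (T x) - ?C (T x)) - (\<Sum>i\<in>Basis. ((\<sigma>\<^sup>2 *\<^sub>R T (gain i)) \<bullet> x) *\<^sub>R gain i)" for x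
    unfolding Cpr_W_C F.diff gain.diff gain_F_Cpr
    by (simp add: gain_F C_W_C T_sym inner_commute[of "gain _"])
  have gF: "bounded_linear (\<lambda>x. gain (F x))"
    by (rule bounded_linear_compose[OF gain.bounded_linear_axioms F_bounded])
  have "bounded_linear (\<lambda>x. data_precision (?C (T x)))"
    by (intro bounded_linear_compose[OF W.bounded_linear_axioms]
        bounded_linear_compose[OF Cpost.bounded_linear_axioms] T_lin)
  hence "op_trace (\<lambda>x. Cpr (data_precision (?C (T (gain (F x))))))
      = op_trace (\<lambda>x. gain (F (Cpr (data_precision (?C (T x))))))"
    using op_trace_commute[OF trace_class_comp_right[OF Cpr_trace_class] gF] by simp
  also have "\<dots> = op_trace (\<lambda>x. Cpr (T x)) - op_trace (\<lambda>x. ?C (T x))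
      - (\<Sum>i\<in>Basis. (\<sigma>\<^sup>2 *\<^sub>R T (gain i)) \<bullet> gain i)"
    unfolding PN
    by (intro op_trace_eqI has_trace_diff has_trace_finite_rank finite_Basis trace_class_has_trace
        trace_class_comp_right[OF Cpr_trace_class T_lin] trace_class_comp_right[OF trace_class_post_cov T_lin])
  finally show ?thesis by (simp add: sum_distrib_left)
qed

end

section \<open>Expected posterior variance\<close>

theorem theorem2:
  fixes \<Omega> :: "(real ^ 'n) set"
    and cls :: "(real ^ 'n \<Rightarrow> real) \<Rightarrow> 'h::{real_inner, banach, second_countable_topology}"
    and a1 a2 \<sigma> :: real
    and F :: "'h \<Rightarrow> real ^ 'd"
    and Cpr Cpost H :: "'h \<Rightarrow> 'h"
    and mpr mb g :: 'h
    and \<mu>pr :: "'h measure"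
    and lik :: "'h \<Rightarrow> (real ^ 'd) measure"
    and \<mu>post :: "real ^ 'd \<Rightarrow> 'h measure"
    and Z Zquad :: "'h \<Rightarrow> real"
  assumes "CARD('n) = 2 \<or> CARD('n) = 3"
    and "bounded_domain \<Omega>"
    and "L2_space \<Omega> cls"
    and "a1 > 0" and "a2 > 0"
    and "Cpr = prior_cov \<Omega> cls a1 a2"
    and "selfadjoint_op Cpr" and "strictly_positive_op Cpr" and "trace_class_op Cpr"
    and "mpr \<in> range Cpr"
    and "gaussian_measure \<mu>pr mpr Cpr"
    and "bounded_linear F"
    and "\<sigma> > 0"
    and "\<And>m. gaussian_measure (lik m) (F m) (\<lambda>v. \<sigma>\<^sup>2 *\<^sub>R v)"
    and "Cpost = post_cov Cpr F \<sigma>"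
    and "\<And>y. gaussian_measure (\<mu>post y) (map_point Cpr mpr F \<sigma> y) Cpost"
    and "twice_differentiable Z"
    and "g = gradient Z mb"
    and "H = hessian Z mb"
    and "Zquad = quad_approx Z mb"
  shows "(\<forall>y. integrable (\<mu>post y) (\<lambda>m. (Zquad m)\<^sup>2)) \<and>
    (\<forall>m. integrable (lik m) (\<lambda>y. prob_space.variance (\<mu>post y) Zquad)) \<and>
    integrable \<mu>pr (\<lambda>m. \<integral>y. prob_space.variance (\<mu>post y) Zquad \<partial>lik m) \<and>
    trace_class_op (Cpr \<circ> H \<circ> Cpost \<circ> H) \<and>
    trace_class_op ((Cpost \<circ> H) ^^ 2) \<and>
    (\<integral>m. (\<integral>y. prob_space.variance (\<mu>post y) Zquad \<partial>lik m) \<partial>\<mu>pr) =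
      weighted_norm_sq Cpost (H (mpr - mb) + g)
      + op_trace (Cpr \<circ> H \<circ> Cpost \<circ> H)
      - 1 / 2 * op_trace ((Cpost \<circ> H) ^^ 2)"
proof -
  define C where "C = post_cov Cpr F \<sigma>"
  have Cpost_eq: "Cpost = C" using assms(15) by (simp add: C_def)
  interpret lip: linear_inverse_problem Cpr F \<sigma>
    by (rule linear_inverse_problem.intro[OF assms(7,8,9,12,13)])
  note Cpr_tc = lip.Cpr_trace_class
  have C_tc: "trace_class_op C" unfolding C_def by (rule lip.trace_class_post_cov)
  interpret post: trace_class_gaussian "\<mu>post y" "map_point Cpr mpr F \<sigma> y" C for y
    using assms(16) C_tc by unfold_locales (simp_all add: Cpost_eq)
  interpret prior: trace_class_gaussian \<mu>pr mpr Cpr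
    using assms(11) Cpr_tc by unfold_locales
  interpret lik: trace_class_gaussian "lik m" "F m" "\<lambda>v. \<sigma>\<^sup>2 *\<^sub>R v" for m
    using assms(14) trace_class_scaleR_euclidean by unfold_locales
  have C_sa: "selfadjoint_op C" by (rule post.selfadjoint_cov)
  have C_sym: "\<And>x y. C x \<bullet> y = x \<bullet> C y" by (rule post.cov_symmetric)
  have H_sa: "selfadjoint_op H" using selfadjoint_hessian assms(17,19) by blast
  hence H_lin: "bounded_linear H" and H_sym: "\<And>x y. H x \<bullet> y = x \<bullet> H y"
    by (auto simp: selfadjoint_op_def)
  interpret H: bounded_linear H by (rule H_lin)

  define T where "T x = H (C (H x))" for x
  have T_lin: "bounded_linear T"
    unfolding T_def by (intro bounded_linear_compose[OF H_lin]
        bounded_linear_compose[OF post.bounded_linear_cov] H_lin)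
  have T_sa: "selfadjoint_op T"
    unfolding selfadjoint_op_def using T_lin by (simp add: T_def H_sym C_sym)
  define l0 where "l0 = g + H (mpr - mb)"
  define t2 where "t2 = op_trace (\<lambda>x. C (T x))"
  define U where "U y = H (lip.gain y)" for y
  have U_lin: "bounded_linear U"
    unfolding U_def by (intro bounded_linear_compose[OF H_lin] lip.gain.bounded_linear_axioms)
  interpret U: bounded_linear U by (rule U_lin)

  (* Expansion of the quadratic approximation about the MAP point instead of mb. *)
  have Zq: "Zquad = (\<lambda>x. (Z mb + g \<bullet> (map_point Cpr mpr F \<sigma> y - mb)
        + 1/2 * (H (map_point Cpr mpr F \<sigma> y - mb) \<bullet> (map_point Cpr mpr F \<sigma> y - mb)))
      + (l0 + U (y - F mpr)) \<bullet> (x - map_point Cpr mpr F \<sigma> y)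
      + 1/2 * (H (x - map_point Cpr mpr F \<sigma> y) \<bullet> (x - map_point Cpr mpr F \<sigma> y)))" for y
  proof
    fix x
    define h where "h = map_point Cpr mpr F \<sigma> y - mb"
    define k where "k = x - map_point Cpr mpr F \<sigma> y"
    have xmb: "x - mb = h + k" by (simp add: h_def k_def)
    have l: "l0 + U (y - F mpr) = g + H h"
      unfolding h_def l0_def U_def lip.map_point_eq[OF assms(10)]
      by (simp add: H.add[symmetric] algebra_simps)
    have "H k \<bullet> h = H h \<bullet> k" using H_sym[of k h] by (simp add: inner_commute)
    hence "Zquad x = (Z mb + g \<bullet> h + 1/2 * (H h \<bullet> h)) + (g + H h) \<bullet> k + 1/2 * (H k \<bullet> k)"
      unfolding assms(20) quad_approx_def assms(18)[symmetric] assms(19)[symmetric] xmb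
      by (simp add: H.add inner_add_left inner_add_right algebra_simps)
    thus "Zquad x = (Z mb + g \<bullet> (map_point Cpr mpr F \<sigma> y - mb)
        + 1/2 * (H (map_point Cpr mpr F \<sigma> y - mb) \<bullet> (map_point Cpr mpr F \<sigma> y - mb)))
      + (l0 + U (y - F mpr)) \<bullet> (x - map_point Cpr mpr F \<sigma> y)
      + 1/2 * (H (x - map_point Cpr mpr F \<sigma> y) \<bullet> (x - map_point Cpr mpr F \<sigma> y))"
      unfolding l h_def[symmetric] k_def[symmetric] .
  qed
  have sq_int: "integrable (\<mu>post y) (\<lambda>m. (Zquad m)\<^sup>2)" for y
    by (rule post.quadratic_square_integrable[OF H_sa Zq])
  have var: "prob_space.variance (\<mu>post y) Zquad
      = C (l0 + U (y - F mpr)) \<bullet> (l0 + U (y - F mpr)) + 1/2 * t2" for y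
    using post.quadratic_variance_eq[OF H_sa Zq] by (simp add: t2_def T_def)

  define \<kappa> where "\<kappa> = op_trace (\<lambda>x. \<sigma>\<^sup>2 *\<^sub>R adjoint U (C (U x)))"
  (* Given m, the data are F m plus noise, so y - F mpr is split into F (m - mpr) and the noise. *)
  have lik_mean: "has_bochner_integral (lik m) (\<lambda>y. prob_space.variance (\<mu>post y) Zquad)
      (C (l0 + U (F (m - mpr))) \<bullet> (l0 + U (F (m - mpr))) + \<kappa> + 1/2 * t2)" for m
  proof -
    have "l0 + U (y - F mpr) = (l0 + U (F (m - mpr))) + U (y - F m)" for y
      by (simp add: U.diff lip.F.diff)
    thus ?thesis unfolding var \<kappa>_def
      by (simp only:) (intro has_bochner_integral_add lik.affine_quadratic_mean[OF C_sa U_lin]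
          lik.has_bochner_integral_const)
  qed
  have UF_lin: "bounded_linear (\<lambda>x. U (F x))"
    by (rule bounded_linear_compose[OF U_lin lip.F_bounded])
  define \<tau> where "\<tau> = op_trace (\<lambda>x. Cpr (adjoint (\<lambda>x. U (F x)) (C (U (F x)))))"
  have total: "has_bochner_integral \<mu>pr (\<lambda>m. \<integral>y. prob_space.variance (\<mu>post y) Zquad \<partial>lik m)
      (C l0 \<bullet> l0 + \<tau> + \<kappa> + 1/2 * t2)"
    unfolding has_bochner_integral_integral_eq[OF lik_mean] \<tau>_def
    by (intro has_bochner_integral_add prior.affine_quadratic_mean[OF C_sa UF_lin]
        prior.has_bochner_integral_const)

  have \<kappa>: "\<kappa> = \<sigma>\<^sup>2 * (\<Sum>i\<in>Basis. T (lip.gain i) \<bullet> lip.gain i)"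
  proof -
    have "bounded_linear (\<lambda>x. adjoint U (C (U x)))"
      by (intro bounded_linear_compose[OF bounded_linear_adjoint[OF U_lin]]
          bounded_linear_compose[OF post.bounded_linear_cov] U_lin)
    from trace_class_comp_right[OF trace_class_scaleR_euclidean this]
    have "\<kappa> = (\<Sum>i\<in>Basis. (\<sigma>\<^sup>2 *\<^sub>R adjoint U (C (U i))) \<bullet> i)"
      unfolding \<kappa>_def by (rule op_trace_euclidean)
    thus ?thesis
      by (simp add: sum_distrib_left adjoint_inner'[OF U_lin] U_def T_def H_sym)
  qed
  have \<tau>: "\<tau> = op_trace (\<lambda>x. Cpr (lip.data_precision (C (T (lip.gain (F x))))))"
  proof -
    have "U (F x) \<bullet> y = x \<bullet> lip.data_precision (C (H y))" for x y
      unfolding U_def lip.gain_F C_def[symmetric] by (simp add: H_sym C_sym lip.W_sym)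
    hence "adjoint (\<lambda>x. U (F x)) = (\<lambda>y. lip.data_precision (C (H y)))"
      by (intro adjoint_unique) blast
    thus ?thesis unfolding \<tau>_def by (simp add: U_def T_def)
  qed
  (* \<tau> comes from the prior uncertainty, \<kappa> from the noise. *)
  have trace_eq: "\<tau> + \<kappa> = op_trace (\<lambda>x. Cpr (T x)) - t2"
    using lip.op_trace_map_point_cov[OF C_sym[unfolded C_def] T_sa]
    unfolding \<tau> \<kappa> t2_def C_def .

  have prior_op: "Cpr \<circ> H \<circ> Cpost \<circ> H = (\<lambda>x. Cpr (T x))"
    by (simp add: Cpost_eq T_def fun_eq_iff)
  have post_op: "(Cpost \<circ> H) ^^ 2 = (\<lambda>x. C (T x))"
    by (simp add: Cpost_eq T_def fun_eq_iff numeral_2_eq_2)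
  have "C l0 \<bullet> l0 + \<tau> + \<kappa> + 1/2 * t2
      = weighted_norm_sq Cpost (H (mpr - mb) + g)
        + op_trace (Cpr \<circ> H \<circ> Cpost \<circ> H) - 1 / 2 * op_trace ((Cpost \<circ> H) ^^ 2)"
    using trace_eq unfolding prior_op post_op t2_def[symmetric] weighted_norm_sq_def
    by (simp add: l0_def Cpost_eq add.commute)
  with sq_int lik_mean total show ?thesis
    unfolding prior_op post_op
    by (auto simp: has_bochner_integral_iff intro: trace_class_comp_right Cpr_tc C_tc T_lin)
qed

end
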